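(* Let $H_1,\dots,H_K$ satisfy assumptions (a), (b), (c) of the context. For each $\epsilon>0$ let $u^{\epsilon}$ denote the unique bounded viscosity solution of $$u^{\epsilon}-\epsilon u^{\epsilon}_{x_ix_i}+H_i(x,u^{\epsilon}_{x_i})=0 \ \text{ in } I_i\ (i=1,\dots,K),\qquad \sum_{i=1}^K u^{\epsilon}_{x_i}=0\ \text{ on }\{0\},$$ and let $L=\sup\{\mathrm{Lip}(u^{\epsilon}) : \epsilon>0\}$. There is a constant $C>0$, depending only on $L$, on the constant $M$ from (c), and on the Lipschitz constant of each $H_i$ in $\overline{I_i}\times[-L,L]$, such that if $u$ is the unique bounded viscosity solution of $$u+H_i(x,u_{x_i})=0\ \text{ in } I_i\ (i=1,\dots,K),\qquad \sum_{i=1}^K u_{x_i}=0\ \text{ on }\{0\},$$ then for every $\epsilon>0$ $$\sup\{|u^{\epsilon}(x)-u(x)| : x\in\mathcal I\}\le C\epsilon^{1/2}.$$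
   Context: Junction: fix an integer $K\ge 1$ and $K$ copies $I_1,\dots,I_K$ of $(-\infty,0)$. $\mathcal I=\bigcup_{i=1}^K\overline{I_i}$ is the union of the half-lines $\overline{I_i}=(-\infty,0]$ glued at $0$, with metric $d(x,y)=|x-y|$ if $x,y$ lie in a common $\overline{I_i}$ and $d(x,y)=|x|+|y|$ otherwise. $\mathrm{Lip}(u)=\sup_{x\neq y}|u(x)-u(y)|/d(x,y)$. For $\varphi:\mathcal I\to\mathbb R$, $\varphi_{x_i},\varphi_{x_ix_i}$ are the derivatives along $\overline{I_i}$ (one-sided at $0$, in the coordinate $x\le 0$). $C^2(\mathcal I)$ is the set of continuous $\varphi$ on $\mathcal I$ whose restriction to each $\overline{I_i}$ is $C^2$ (derivatives at $0$ along different edges may differ). Assumptions on $H_i:\overline{I_i}\times\mathbb R\to\mathbb R$, $i=1,\dots,K$: (a) for each $R>0$, $H_i$ is uniformly Lipschitz continuous on $\overline{I_i}\times[-R,R]$; (b) $\lim_{|p|\to\infty}H_i(x,p)=\infty$ uniformly in $x$; (c) $M:=\sup\{|H_i(x,0)| : x\in\overline{I_i},\ 1\le i\le K\}<\infty$. Viscosity solutions: for $F_i(x,u,u_{x_i},u_{x_ix_i})=0$ in $I_i$, $\sum_i u_{x_i}=0$ on $\{0\}$, an upper (resp. lower) semi-continuous $u:\mathcal I\to\mathbb R$ is a sub-solution (resp. super-solution) if whenever $\varphi\in C^2(\mathcal I)$ and $u-\varphi$ has a local maximum (resp. minimum) at $x_0$: if $x_0\in I_i$, then $F_i(x_0,u(x_0),\varphi_{x_i}(x_0),\varphi_{x_ix_i}(x_0))\le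 0$ (resp. $\ge 0$); if $x_0=0$, then $\min\{\sum_i\varphi_{x_i}(0),\min_iF_i(0,u(0),\varphi_{x_i}(0),\varphi_{x_ix_i}(0))\}\le 0$ (resp. $\max\{\sum_i\varphi_{x_i}(0),\max_iF_i(0,u(0),\varphi_{x_i}(0),\varphi_{x_ix_i}(0))\}\ge 0$). A viscosity solution is a continuous function that is both. Unique bounded solutions of both problems exist under (a)-(c). *)

theory Defs
  imports "HOL-Analysis.Analysis"
begin

section \<open>The junction\<close>

text \<open>
  The half-lines are indexed by a finite type \<open>'k\<close> with \<open>CARD('k) = K\<close> (types are nonempty, so
  \<open>K \<ge> 1\<close> is automatic). The junction is the quotient of \<open>'k \<times> (-\<infinity>, 0]\<close> that identifies all
  points \<open>(i, 0)\<close>.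
\<close>

definition junction_rel :: "'k \<times> real \<Rightarrow> 'k \<times> real \<Rightarrow> bool" where
  "junction_rel a b \<longleftrightarrow> snd a \<le> 0 \<and> snd b \<le> 0 \<and> (a = b \<or> (snd a = 0 \<and> snd b = 0))"

quotient_type 'k junction = "'k \<times> real" / partial: junction_rel
proof (rule part_equivpI)
  show "\<exists>a :: 'k \<times> real. junction_rel a a"
    by (rule exI[of _ "(undefined, 0)"]) (simp add: junction_rel_def)
  show "symp (junction_rel :: 'k \<times> real \<Rightarrow> _)"
    by (auto simp: symp_def junction_rel_def)
  show "transp (junction_rel :: 'k \<times> real \<Rightarrow> _)"
    by (auto simp: transp_def junction_rel_def)
qed

text \<open>
  \<open>edge i x\<close> is the point with coordinate \<open>x \<le> 0\<close> on the \<open>i\<close>-th closed half-line. The truncation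
  only serves to make the function total; positive \<open>x\<close> are never relevant.
\<close>

lift_definition edge :: "'k \<Rightarrow> real \<Rightarrow> 'k junction" is "\<lambda>i x. (i, min x 0)"
  by (simp add: junction_rel_def)

definition vertex :: "'k junction" where
  "vertex = edge undefined 0"

instantiation junction :: (type) metric_space
begin

lift_definition dist_junction :: "'a junction \<Rightarrow> 'a junction \<Rightarrow> real"
  is "\<lambda>(i, x) (j, y). if i = j then \<bar>x - y\<bar> else \<bar>x\<bar> + \<bar>y\<bar>"
  by (auto simp: junction_rel_def)

definition uniformity_junction :: "('a junction \<times> 'a junction) filter" where
  "uniformity_junction = (INF e\<in>{0 <..}. principal {(x, y). dist x y < e})"

definition open_junction :: "'a junction set \<Rightarrow> bool" where
  "open_junction U \<longleftrightarrow> (\<forall>x\<in>U. eventually (\<lambda>(x', y). x' = x \<longrightarrow> y \<in> U) uniformity)"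

instance
proof
  show "dist x y = 0 \<longleftrightarrow> x = y" for x y :: "'a junction"
    by transfer (force simp: junction_rel_def split: if_split_asm)
  show "dist x y \<le> dist x z + dist y z" for x y z :: "'a junction"
  proof transfer
    fix a b c :: "'a \<times> real"
    show "(case a of (i, x) \<Rightarrow> \<lambda>(j, y). if i = j then \<bar>x - y\<bar> else \<bar>x\<bar> + \<bar>y\<bar>) b
      \<le> (case a of (i, x) \<Rightarrow> \<lambda>(j, y). if i = j then \<bar>x - y\<bar> else \<bar>x\<bar> + \<bar>y\<bar>) c
        + (case b of (i, x) \<Rightarrow> \<lambda>(j, y). if i = j then \<bar>x - y\<bar> else \<bar>x\<bar> + \<bar>y\<bar>) c"
      by (cases a; cases b; cases c) (auto simp: abs_if)
  qed
qed (fact uniformity_junction_def open_junction_def)+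

end

lemma edge_zero [simp]: "edge i 0 = vertex"
  unfolding vertex_def by transfer (simp add: junction_rel_def)

lemma junction_cases:
  fixes p :: "'k junction"
  obtains i x where "x \<le> 0" "p = edge i x"
proof -
  have "\<exists>i x. x \<le> 0 \<and> p = edge i x"
  proof (induct p rule: junction.abs_induct)
    case (1 a)
    then have "snd a \<le> 0" "abs_junction a = edge (fst a) (snd a)"
      by (simp_all add: junction_rel_def edge.abs_eq)
    then show ?case by blast
  qed
  with that show thesis by blast
qed

lemma dist_edge:
  assumes "x \<le> 0" "y \<le> 0"
  shows "dist (edge i x) (edge j y) = (if i = j then \<bar>x - y\<bar> else \<bar>x\<bar> + \<bar>y\<bar>)"
  using assms by transfer (auto simp: min_def)

section \<open>Lipschitz constants\<close>

text \<open>The least Lipschitz constant of \<open>f\<close> on \<open>S\<close>; it is \<open>\<infinity>\<close> if \<open>f\<close> is not Lipschitz on \<open>S\<close>.\<close>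

definition Lip_on :: "'a::metric_space set \<Rightarrow> ('a \<Rightarrow> 'b::metric_space) \<Rightarrow> ennreal" where
  "Lip_on S f = (SUP x\<in>S. SUP y\<in>S - {x}. ennreal (dist (f x) (f y) / dist x y))"

section \<open>Smooth functions on the junction\<close>

text \<open>
  \<open>edge_D \<phi> i x\<close> and \<open>edge_D2 \<phi> i x\<close> are the first and second derivatives along the \<open>i\<close>-th closed
  half-line at the coordinate \<open>x \<le> 0\<close>; they are one-sided at \<open>x = 0\<close>.
\<close>

definition edge_D :: "('k junction \<Rightarrow> real) \<Rightarrow> 'k \<Rightarrow> real \<Rightarrow> real" where
  "edge_D \<phi> i x = vector_derivative (\<lambda>y. \<phi> (edge i y)) (at x within {..0})"

definition edge_D2 :: "('k junction \<Rightarrow> real) \<Rightarrow> 'k \<Rightarrow> real \<Rightarrow> real" where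
  "edge_D2 \<phi> i x = vector_derivative (edge_D \<phi> i) (at x within {..0})"

definition C2_junction :: "('k junction \<Rightarrow> real) \<Rightarrow> bool" where
  "C2_junction \<phi> \<longleftrightarrow>
     continuous_on UNIV \<phi> \<and>
     (\<forall>i. (\<lambda>y. \<phi> (edge i y)) differentiable_on {..0} \<and>
          edge_D \<phi> i differentiable_on {..0} \<and>
          continuous_on {..0} (edge_D2 \<phi> i))"

section \<open>Viscosity solutions of the Kirchhoff problem\<close>

definition upper_semicont :: "('a::topological_space \<Rightarrow> real) \<Rightarrow> bool" where
  "upper_semicont u \<longleftrightarrow> (\<forall>c. open {x. u x < c})"

definition lower_semicont :: "('a::topological_space \<Rightarrow> real) \<Rightarrow> bool" where
  "lower_semicont u \<longleftrightarrow> (\<forall>c. open {x. c < u x})"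

definition local_max_at :: "('a::topological_space \<Rightarrow> real) \<Rightarrow> 'a \<Rightarrow> bool" where
  "local_max_at f x0 \<longleftrightarrow> (\<forall>\<^sub>F x in nhds x0. f x \<le> f x0)"

definition local_min_at :: "('a::topological_space \<Rightarrow> real) \<Rightarrow> 'a \<Rightarrow> bool" where
  "local_min_at f x0 \<longleftrightarrow> (\<forall>\<^sub>F x in nhds x0. f x0 \<le> f x)"

text \<open>
  In the following, \<open>F i x r p X\<close> stands for \<open>F\<^sub>i(x, u, u\<^sub>x, u\<^sub>x\<^sub>x)\<close>; only its values for \<open>x \<le> 0\<close> matter.
\<close>

definition kirchhoff_sub ::
  "('k::finite \<Rightarrow> real \<Rightarrow> real \<Rightarrow> real \<Rightarrow> real \<Rightarrow> real) \<Rightarrow> ('k junction \<Rightarrow> real) \<Rightarrow> bool" where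
  "kirchhoff_sub F u \<longleftrightarrow>
     upper_semicont u \<and>
     (\<forall>\<phi>. C2_junction \<phi> \<longrightarrow>
        (\<forall>i. \<forall>x<0. local_max_at (\<lambda>z. u z - \<phi> z) (edge i x) \<longrightarrow>
            F i x (u (edge i x)) (edge_D \<phi> i x) (edge_D2 \<phi> i x) \<le> 0) \<and>
        (local_max_at (\<lambda>z. u z - \<phi> z) vertex \<longrightarrow>
            min (\<Sum>i\<in>UNIV. edge_D \<phi> i 0)
                (MIN i. F i 0 (u vertex) (edge_D \<phi> i 0) (edge_D2 \<phi> i 0)) \<le> 0))"

definition kirchhoff_super ::
  "('k::finite \<Rightarrow> real \<Rightarrow> real \<Rightarrow> real \<Rightarrow> real \<Rightarrow> real) \<Rightarrow> ('k junction \<Rightarrow> real) \<Rightarrow> bool" where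
  "kirchhoff_super F u \<longleftrightarrow>
     lower_semicont u \<and>
     (\<forall>\<phi>. C2_junction \<phi> \<longrightarrow>
        (\<forall>i. \<forall>x<0. local_min_at (\<lambda>z. u z - \<phi> z) (edge i x) \<longrightarrow>
            F i x (u (edge i x)) (edge_D \<phi> i x) (edge_D2 \<phi> i x) \<ge> 0) \<and>
        (local_min_at (\<lambda>z. u z - \<phi> z) vertex \<longrightarrow>
            max (\<Sum>i\<in>UNIV. edge_D \<phi> i 0)
                (MAX i. F i 0 (u vertex) (edge_D \<phi> i 0) (edge_D2 \<phi> i 0)) \<ge> 0))"

definition kirchhoff_sol ::
  "('k::finite \<Rightarrow> real \<Rightarrow> real \<Rightarrow> real \<Rightarrow> real \<Rightarrow> real) \<Rightarrow> ('k junction \<Rightarrow> real) \<Rightarrow> bool" where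
  "kirchhoff_sol F u \<longleftrightarrow> continuous_on UNIV u \<and> kirchhoff_sub F u \<and> kirchhoff_super F u"

definition bounded_kirchhoff_sol ::
  "('k::finite \<Rightarrow> real \<Rightarrow> real \<Rightarrow> real \<Rightarrow> real \<Rightarrow> real) \<Rightarrow> ('k junction \<Rightarrow> real) \<Rightarrow> bool" where
  "bounded_kirchhoff_sol F u \<longleftrightarrow> bounded (range u) \<and> kirchhoff_sol F u"

section \<open>Hamiltonians\<close>

text \<open>\<open>H i x p\<close> is only meaningful for \<open>x \<le> 0\<close>.\<close>

definition Lipschitz_on_strips :: "('k \<Rightarrow> real \<Rightarrow> real \<Rightarrow> real) \<Rightarrow> bool" where
  "Lipschitz_on_strips H \<longleftrightarrow>
     (\<forall>i. \<forall>R>0. \<exists>c. c-lipschitz_on ({..0} \<times> {-R..R}) (\<lambda>(x, p). H i x p))"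

definition uniformly_coercive :: "('k \<Rightarrow> real \<Rightarrow> real \<Rightarrow> real) \<Rightarrow> bool" where
  "uniformly_coercive H \<longleftrightarrow>
     (\<forall>i. \<forall>B. \<exists>R. \<forall>x\<le>0. \<forall>p. \<bar>p\<bar> \<ge> R \<longrightarrow> H i x p \<ge> B)"

definition bounded_at_zero :: "('k \<Rightarrow> real \<Rightarrow> real \<Rightarrow> real) \<Rightarrow> bool" where
  "bounded_at_zero H \<longleftrightarrow> bdd_above ((\<lambda>(i, x). \<bar>H i x 0\<bar>) ` (UNIV \<times> {..0}))"

definition H_bound :: "('k \<Rightarrow> real \<Rightarrow> real \<Rightarrow> real) \<Rightarrow> real" where
  "H_bound H = (SUP (i, x)\<in>UNIV \<times> {..0}. \<bar>H i x 0\<bar>)"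

definition H_Lip :: "('k \<Rightarrow> real \<Rightarrow> real \<Rightarrow> real) \<Rightarrow> ennreal \<Rightarrow> 'k \<Rightarrow> ennreal" where
  "H_Lip H L i = Lip_on ({..0} \<times> {p. ennreal \<bar>p\<bar> \<le> L}) (\<lambda>(x, p). H i x p)"

end

theory Submission
  imports Defs
begin

text \<open>
  Write \<open>\<eta> = \<surd>\<epsilon>\<close>. By the reflection \<open>u \<mapsto> -u\<close>, \<open>H i x p \<mapsto> - H i x (- p)\<close>, which exchanges
  sub- and supersolutions, it suffices to bound \<open>v - u\<close> by \<open>C * \<eta>\<close> for an \<open>L\<close>-Lipschitz subsolution
  \<open>v\<close> of the viscous problem and a supersolution \<open>u\<close> of the first-order problem. The Hamiltonians
  are neither convex nor comparable across edges, so doubling variables across the junction is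
  useless. Instead the variables are doubled along one edge at a time, and the test function is
  tilted on each edge by a slope \<open>\<alpha> i\<close>, chosen from \<open>v\<close>, such that \<open>\<Sum>\<alpha> < 0\<close>.

  The slopes come from the second-order term. On edge \<open>i\<close> let \<open>s i\<close> be the largest slope for which
  the parabola \<open>v(0) + s x + x\<^sup>2 / (2\<eta>)\<close> stays above \<open>v\<close>. For \<open>\<epsilon> > 0\<close> the Kirchhoff condition holds in
  the strong form \<open>\<Sum>s \<le> 0\<close>, since the second derivatives of a test function at the vertex may be
  made so negative that the equations on the edges cannot be the ones that hold
  (\<open>viscous_sub_vertex_slopes\<close>). A slightly steeper parabola, pushed down, touches \<open>v\<close> from above at a
  point \<open>t i\<close> inside the edge, at distance \<open>O(\<eta>)\<close> from the vertex, with a slope \<open>a i\<close> that is at most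
  \<open>s i\<close> up to an arbitrarily small tolerance (\<open>parabola_contact_point\<close>); there the equation gives
  \<open>v + H i (t i) (a i) \<le> \<eta>\<close>. Cutting off the layer between \<open>t i\<close> and the vertex changes \<open>v\<close> by \<open>O(\<eta>)\<close>
  only. What remains of \<open>v\<close>, shifted so that \<open>t i\<close> becomes the origin, is compared with \<open>u\<close> through a
  maximum of \<open>V i x - u i y - \<alpha> i (x - y) - (x - y)\<^sup>2 / (2\<eta>)\<close> over all edges \<open>i\<close> and \<open>x, y \<le> 0\<close>
  (\<open>one_sided_estimate_with_tolerance\<close>). At an interior maximum the two equations are subtracted as
  usual. A maximum with \<open>y = 0 > x\<close> contradicts the parabola above \<open>V\<close>. At one with \<open>x = 0 > y\<close> the
  slope cannot exceed \<open>a i\<close>, because a viscous subsolution has no concave kink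
  (\<open>viscous_sub_no_concave_kink\<close>). At \<open>x = y = 0\<close> the slopes \<open>\<alpha>\<close> are admissible in the
  vertex condition of \<open>u\<close> on all edges at once, and since \<open>\<Sum>\<alpha> < 0\<close> the equation of \<open>u\<close> holds on some
  edge \<open>j\<close>, where it is compared with the inequality for \<open>v\<close> at \<open>t j\<close>.

  All constants involve only \<open>L\<close> and the Lipschitz constants of the \<open>H i\<close> in \<open>x\<close> for slopes in
  \<open>[-L, L]\<close>, provided that \<open>L\<close> is finite. This last point follows from coercivity
  (\<open>viscous_solutions_equi_Lipschitz\<close>), again by test functions: lines that are too steep cannot touch a
  subsolution from above. Every test function in the whole argument is a quadratic polynomial on
  each edge.
\<close>

section \<open>Piecewise quadratic test functions\<close>

lemma eventually_nhds_vertex: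
  "(\<forall>\<^sub>F z in nhds (vertex :: 'k junction). P z) \<longleftrightarrow>
     (\<exists>r>0. \<forall>i. \<forall>x\<le>0. \<bar>x\<bar> < r \<longrightarrow> P (edge i x))"
proof -
  have d: "dist (edge i x) vertex = \<bar>x\<bar>" if "x \<le> 0" for i :: 'k and x
    using dist_edge[of x 0 i i] that by simp
  show ?thesis
    unfolding eventually_nhds_metric
  proof (intro ex_cong conj_cong refl iffI allI impI)
    fix r :: real and i :: 'k and x
    assume "\<forall>z. dist z vertex < r \<longrightarrow> P z" "x \<le> 0" "\<bar>x\<bar> < r"
    then show "P (edge i x)" using d by metis
  next
    fix r :: real and z
    assume P: "\<forall>i. \<forall>x\<le>0. \<bar>x\<bar> < r \<longrightarrow> P (edge i x)" and "dist z (vertex :: 'k junction) < r"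
    obtain i x where "x \<le> 0" "z = edge i x" by (rule junction_cases)
    then show "P z" using P d \<open>dist z vertex < r\<close> by auto
  qed
qed

lemma eventually_nhds_edge:
  assumes "x0 < 0"
  shows "(\<forall>\<^sub>F z in nhds (edge i x0). P z) \<longleftrightarrow>
     (\<exists>r>0. \<forall>x\<le>0. \<bar>x - x0\<bar> < r \<longrightarrow> P (edge i x))"
proof
  assume "\<forall>\<^sub>F z in nhds (edge i x0). P z"
  then obtain d where "d > 0" and d: "\<And>z. dist z (edge i x0) < d \<Longrightarrow> P z"
    unfolding eventually_nhds_metric by blast
  then show "\<exists>r>0. \<forall>x\<le>0. \<bar>x - x0\<bar> < r \<longrightarrow> P (edge i x)"
    using assms by (intro exI[of _ d]) (auto simp: dist_edge)
next
  assume "\<exists>r>0. \<forall>x\<le>0. \<bar>x - x0\<bar> < r \<longrightarrow> P (edge i x)"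
  then obtain r where "r > 0" and r: "\<And>x. x \<le> 0 \<Longrightarrow> \<bar>x - x0\<bar> < r \<Longrightarrow> P (edge i x)"
    by blast
  have "P z" if "dist z (edge i x0) < min r \<bar>x0\<bar>" for z
  proof (cases z rule: junction_cases)
    case (1 j x)
    then show ?thesis
      using that r[of x] assms by (auto simp: dist_edge split: if_splits)
  qed
  then show "\<forall>\<^sub>F z in nhds (edge i x0). P z"
    unfolding eventually_nhds_metric using \<open>r > 0\<close> assms
    by (intro exI[of _ "min r \<bar>x0\<bar>"]) auto
qed

lift_definition edge_quadratic ::
  "real \<Rightarrow> ('k \<Rightarrow> real) \<Rightarrow> ('k \<Rightarrow> real) \<Rightarrow> 'k junction \<Rightarrow> real"
  is "\<lambda>c p X (i, x). c + p i * x + X i / 2 * x\<^sup>2"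
  by (auto simp: junction_rel_def)

lemma edge_quadratic_edge:
  "x \<le> 0 \<Longrightarrow> edge_quadratic c p X (edge i x) = c + p i * x + X i / 2 * x\<^sup>2"
  by transfer (simp add: min_def)

lemma edge_quadratic_vertex: "edge_quadratic c p X vertex = c"
  using edge_quadratic_edge[of 0 c p X undefined] by simp

lemma within_atMost_nontrivial: "x \<le> (0::real) \<Longrightarrow> at x within {..0} \<noteq> bot"
  using at_le[of "{..<x}" "{..0}" x] trivial_limit_at_left_real[of x] by (auto simp: subset_eq bot_unique)

lemma edge_quadratic_has_derivative:
  assumes "x \<le> 0"
  shows "((\<lambda>y. edge_quadratic c p X (edge i y)) has_vector_derivative p i + X i * x)
    (at x within {..0})"
proof -
  have "((\<lambda>y. c + p i * y + X i / 2 * y\<^sup>2) has_vector_derivative p i + X i * x)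
    (at x within {..0})"
    unfolding has_real_derivative_iff_has_vector_derivative[symmetric]
    by (auto intro!: derivative_eq_intros)
  then show ?thesis
    by (rule has_vector_derivative_transform[rotated 2])
      (use assms in \<open>auto simp: edge_quadratic_edge\<close>)
qed

lemma edge_D_quadratic:
  assumes "x \<le> 0" shows "edge_D (edge_quadratic c p X) i x = p i + X i * x"
  unfolding edge_D_def
  by (rule vector_derivative_within[OF within_atMost_nontrivial[OF assms]
        edge_quadratic_has_derivative[OF assms]])

lemma edge_D_quadratic_has_derivative:
  assumes "x \<le> 0"
  shows "(edge_D (edge_quadratic c p X) i has_vector_derivative X i) (at x within {..0})"
proof -
  have "((\<lambda>y. p i + X i * y) has_vector_derivative X i) (at x within {..0})"
    unfolding has_real_derivative_iff_has_vector_derivative[symmetric]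
    by (auto intro!: derivative_eq_intros)
  then show ?thesis
    by (rule has_vector_derivative_transform[rotated 2])
      (use assms in \<open>auto simp: edge_D_quadratic\<close>)
qed

lemma edge_D2_quadratic:
  assumes "x \<le> 0" shows "edge_D2 (edge_quadratic c p X) i x = X i"
  unfolding edge_D2_def
  by (rule vector_derivative_within[OF within_atMost_nontrivial[OF assms]
        edge_D_quadratic_has_derivative[OF assms]])

lemma continuous_on_edge_quadratic:
  "continuous_on UNIV (edge_quadratic c p X :: 'k::finite junction \<Rightarrow> real)"
proof -
  define \<phi> where "\<phi> = edge_quadratic c p X"
  have edge: "\<exists>r>0. \<forall>x\<le>0. \<bar>x - x0\<bar> < r \<longrightarrow> dist (\<phi> (edge i x)) (\<phi> (edge i x0)) < e"
    if "x0 \<le> 0" "e > 0" for i x0 e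
  proof -
    have "continuous (at x0) (\<lambda>y. c + p i * y + X i / 2 * y\<^sup>2)" by (intro continuous_intros)
    then obtain r where "r > 0" and
      "\<And>x. dist x x0 < r \<Longrightarrow> dist (c + p i * x + X i / 2 * x\<^sup>2) (c + p i * x0 + X i / 2 * x0\<^sup>2) < e"
      using \<open>e > 0\<close> unfolding continuous_at_eps_delta by blast
    then show ?thesis
      using that by (intro exI[of _ r]) (auto simp: \<phi>_def edge_quadratic_edge dist_real_def)
  qed
  have "(\<phi> \<longlongrightarrow> \<phi> z) (nhds z)" for z
    unfolding tendsto_iff
  proof (intro allI impI)
    fix e :: real assume "e > 0"
    obtain i x0 where z: "x0 \<le> 0" "z = edge i x0" by (rule junction_cases)
    show "\<forall>\<^sub>F y in nhds z. dist (\<phi> y) (\<phi> z) < e"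
    proof (cases "x0 = 0")
      case True
      have "\<forall>i. \<exists>r>0. \<forall>x\<le>0. \<bar>x\<bar> < r \<longrightarrow> dist (\<phi> (edge i x)) (\<phi> vertex) < e"
        using edge[of 0 e] \<open>e > 0\<close> by simp
      then obtain r where r: "\<And>i. r i > 0"
        "\<And>i x. x \<le> 0 \<Longrightarrow> \<bar>x\<bar> < r i \<Longrightarrow> dist (\<phi> (edge i x)) (\<phi> vertex) < e"
        by metis
      then have "\<exists>s>0. \<forall>i. \<forall>x\<le>0. \<bar>x\<bar> < s \<longrightarrow> dist (\<phi> (edge i x)) (\<phi> (vertex :: 'k junction)) < e"
        by (intro exI[of _ "Min (range r)"]) auto
      then show ?thesis using True z by (simp add: eventually_nhds_vertex)
    next
      case False
      then show ?thesis using edge[of x0 e i] z \<open>e > 0\<close> by (simp add: eventually_nhds_edge)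
    qed
  qed
  then have "isCont \<phi> z" for z
    unfolding isCont_def using filterlim_mono[OF _ order_refl at_within_le_nhds] by blast
  then show ?thesis unfolding \<phi>_def by (simp add: continuous_at_imp_continuous_on)
qed

lemma C2_junction_edge_quadratic:
  "C2_junction (edge_quadratic c p X :: 'k::finite junction \<Rightarrow> real)"
  unfolding C2_junction_def
proof (intro conjI allI)
  fix i
  show "(\<lambda>y. edge_quadratic c p X (edge i y)) differentiable_on {..0}"
    "edge_D (edge_quadratic c p X) i differentiable_on {..0}"
    unfolding differentiable_on_def
    by (auto intro!: differentiableI_vector
        intro: edge_quadratic_has_derivative edge_D_quadratic_has_derivative)
  show "continuous_on {..0} (edge_D2 (edge_quadratic c p X) i)"
    by (rule continuous_on_eq[OF continuous_on_const[of _ "X i"]]) (simp add: edge_D2_quadratic)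
qed (rule continuous_on_edge_quadratic)

text \<open>
  The viscosity inequalities restricted to piecewise quadratic test functions, in edge coordinates.
  They concern one-sided touching only, without semicontinuity, and are all that is used of the
  notion of solution. On the edges the test polynomial is centred at the point of contact.
\<close>

definition quad_sub ::
  "('k::finite \<Rightarrow> real \<Rightarrow> real \<Rightarrow> real \<Rightarrow> real \<Rightarrow> real) \<Rightarrow> ('k junction \<Rightarrow> real) \<Rightarrow> bool" where
  "quad_sub F u \<longleftrightarrow>
    (\<forall>i x0 p X r. x0 < 0 \<longrightarrow> r > 0 \<longrightarrow>
      (\<forall>x\<le>0. \<bar>x - x0\<bar> < r \<longrightarrow>
        u (edge i x) \<le> u (edge i x0) + p * (x - x0) + X / 2 * (x - x0)\<^sup>2) \<longrightarrow>
      F i x0 (u (edge i x0)) p X \<le> 0) \<and>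
    (\<forall>p X r. r > 0 \<longrightarrow>
      (\<forall>i. \<forall>x\<le>0. \<bar>x\<bar> < r \<longrightarrow> u (edge i x) \<le> u vertex + p i * x + X i / 2 * x\<^sup>2) \<longrightarrow>
      (\<Sum>i\<in>UNIV. p i) \<le> 0 \<or> (\<exists>i. F i 0 (u vertex) (p i) (X i) \<le> 0))"

text \<open>
  Supersolutions are the reflections of subsolutions; this makes the symmetry between the two halves
  of the final estimate available by definition.
\<close>

definition quad_super ::
  "('k::finite \<Rightarrow> real \<Rightarrow> real \<Rightarrow> real \<Rightarrow> real \<Rightarrow> real) \<Rightarrow> ('k junction \<Rightarrow> real) \<Rightarrow> bool" where
  "quad_super F u \<longleftrightarrow> quad_sub (\<lambda>i x r p X. - F i x (- r) (- p) (- X)) (\<lambda>z. - u z)"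

lemma kirchhoff_sub_imp_quad_sub:
  fixes u :: "'k::finite junction \<Rightarrow> real"
  assumes "kirchhoff_sub F u"
  shows "quad_sub F u"
  unfolding quad_sub_def
proof (intro conjI allI impI)
  fix i x0 and p X r :: real
  assume x0: "x0 < 0" and r: "r > 0" and
    le: "\<forall>x\<le>0. \<bar>x - x0\<bar> < r \<longrightarrow>
        u (edge i x) \<le> u (edge i x0) + p * (x - x0) + X / 2 * (x - x0)\<^sup>2"
  define \<phi> :: "'k junction \<Rightarrow> real" where "\<phi> = edge_quadratic 0 (\<lambda>_. p - X * x0) (\<lambda>_. X :: real)"
  have \<phi>: "\<phi> (edge i x) - \<phi> (edge i x0) = p * (x - x0) + X / 2 * (x - x0)\<^sup>2" if "x \<le> 0" for x
    using that x0 by (simp add: \<phi>_def edge_quadratic_edge power2_eq_square field_simps)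
  have "local_max_at (\<lambda>z. u z - \<phi> z) (edge i x0)"
    unfolding local_max_at_def eventually_nhds_edge[OF x0]
    using le \<phi> by (intro exI[of _ r] conjI r) (smt (verit, best))
  then have "F i x0 (u (edge i x0)) (edge_D \<phi> i x0) (edge_D2 \<phi> i x0) \<le> 0"
    using assms x0 C2_junction_edge_quadratic unfolding kirchhoff_sub_def \<phi>_def by blast
  then show "F i x0 (u (edge i x0)) p X \<le> 0"
    using x0 by (simp add: \<phi>_def edge_D_quadratic edge_D2_quadratic)
next
  fix p X r
  assume r: "(r::real) > 0" and
    le: "\<forall>i. \<forall>x\<le>0. \<bar>x\<bar> < r \<longrightarrow> u (edge i x) \<le> u vertex + p i * x + X i / 2 * x\<^sup>2"
  define \<phi> :: "'k junction \<Rightarrow> real" where "\<phi> = edge_quadratic 0 p X"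
  have "local_max_at (\<lambda>z. u z - \<phi> z) vertex"
    unfolding local_max_at_def eventually_nhds_vertex
    using le by (intro exI[of _ r] conjI r)
      (auto simp: \<phi>_def edge_quadratic_edge edge_quadratic_vertex algebra_simps)
  then have "min (\<Sum>i\<in>UNIV. edge_D \<phi> i 0)
                (MIN i. F i 0 (u vertex) (edge_D \<phi> i 0) (edge_D2 \<phi> i 0)) \<le> 0"
    using assms C2_junction_edge_quadratic unfolding kirchhoff_sub_def \<phi>_def by blast
  then show "(\<Sum>i\<in>UNIV. p i) \<le> 0 \<or> (\<exists>i. F i 0 (u vertex) (p i) (X i) \<le> 0)"
    by (auto simp: \<phi>_def edge_D_quadratic edge_D2_quadratic min_le_iff_disj Min_le_iff)
qed

lemma kirchhoff_super_imp_quad_super: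
  fixes u :: "'k::finite junction \<Rightarrow> real"
  assumes "kirchhoff_super F u"
  shows "quad_super F u"
  unfolding quad_super_def quad_sub_def
proof (intro conjI allI impI)
  fix i x0 and p X r :: real
  assume x0: "x0 < 0" and r: "r > 0" and
    le: "\<forall>x\<le>0. \<bar>x - x0\<bar> < r \<longrightarrow>
        - u (edge i x) \<le> - u (edge i x0) + p * (x - x0) + X / 2 * (x - x0)\<^sup>2"
  define \<phi> :: "'k junction \<Rightarrow> real" where "\<phi> = edge_quadratic 0 (\<lambda>_. - p + X * x0) (\<lambda>_. - X :: real)"
  have \<phi>: "\<phi> (edge i x) - \<phi> (edge i x0) = - p * (x - x0) - X / 2 * (x - x0)\<^sup>2" if "x \<le> 0" for x
    using that x0 by (simp add: \<phi>_def edge_quadratic_edge power2_eq_square field_simps)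
  have "local_min_at (\<lambda>z. u z - \<phi> z) (edge i x0)"
    unfolding local_min_at_def eventually_nhds_edge[OF x0]
    using le \<phi> by (intro exI[of _ r] conjI r) (smt (verit, best) mult_minus_left)
  then have "F i x0 (u (edge i x0)) (edge_D \<phi> i x0) (edge_D2 \<phi> i x0) \<ge> 0"
    using assms x0 C2_junction_edge_quadratic unfolding kirchhoff_super_def \<phi>_def by blast
  then show "- F i x0 (- (- u (edge i x0))) (- p) (- X) \<le> 0"
    using x0 by (simp add: \<phi>_def edge_D_quadratic edge_D2_quadratic)
next
  fix p X r
  assume r: "(r::real) > 0" and
    le: "\<forall>i. \<forall>x\<le>0. \<bar>x\<bar> < r \<longrightarrow> - u (edge i x) \<le> - u vertex + p i * x + X i / 2 * x\<^sup>2"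
  define \<phi> :: "'k junction \<Rightarrow> real" where "\<phi> = edge_quadratic 0 (\<lambda>i. - p i) (\<lambda>i. - X i)"
  have "local_min_at (\<lambda>z. u z - \<phi> z) vertex"
    unfolding local_min_at_def eventually_nhds_vertex
    using le by (intro exI[of _ r] conjI r)
      (auto simp: \<phi>_def edge_quadratic_edge edge_quadratic_vertex algebra_simps)
  then have "max (\<Sum>i\<in>UNIV. edge_D \<phi> i 0)
                (MAX i. F i 0 (u vertex) (edge_D \<phi> i 0) (edge_D2 \<phi> i 0)) \<ge> 0"
    using assms C2_junction_edge_quadratic unfolding kirchhoff_super_def \<phi>_def by blast
  then show "(\<Sum>i\<in>UNIV. p i) \<le> 0 \<or>
      (\<exists>i. - F i 0 (- (- u vertex)) (- p i) (- X i) \<le> 0)"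
    by (auto simp: \<phi>_def edge_D_quadratic edge_D2_quadratic le_max_iff_disj Max_ge_iff sum_negf)
qed

lemma quad_sub_edge:
  assumes "quad_sub F u" "x0 < 0" "r > 0"
    and "\<And>x. x \<le> 0 \<Longrightarrow> \<bar>x - x0\<bar> < r \<Longrightarrow>
        u (edge i x) \<le> u (edge i x0) + p * (x - x0) + X / 2 * (x - x0)\<^sup>2"
  shows "F i x0 (u (edge i x0)) p X \<le> 0"
  using assms unfolding quad_sub_def by blast

lemma quad_sub_vertex:
  assumes "quad_sub F u" "r > 0"
    and "\<And>i x. x \<le> 0 \<Longrightarrow> \<bar>x\<bar> < r \<Longrightarrow> u (edge i x) \<le> u vertex + p i * x + X i / 2 * x\<^sup>2"
  shows "(\<Sum>i\<in>UNIV. p i) \<le> 0 \<or> (\<exists>i. F i 0 (u vertex) (p i) (X i) \<le> 0)"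
  using assms unfolding quad_sub_def by blast

lemma quad_super_edge:
  assumes "quad_super F u" "x0 < 0" "r > 0"
    and "\<And>x. x \<le> 0 \<Longrightarrow> \<bar>x - x0\<bar> < r \<Longrightarrow>
        u (edge i x) \<ge> u (edge i x0) + p * (x - x0) + X / 2 * (x - x0)\<^sup>2"
  shows "F i x0 (u (edge i x0)) p X \<ge> 0"
proof -
  have "- F i x0 (- (- u (edge i x0))) (- (- p)) (- (- X)) \<le> 0"
    by (rule quad_sub_edge[OF assms(1)[unfolded quad_super_def] assms(2,3)])
      (use assms(4) in force)
  then show ?thesis by simp
qed

lemma quad_super_vertex:
  assumes "quad_super F u" "r > 0"
    and "\<And>i x. x \<le> 0 \<Longrightarrow> \<bar>x\<bar> < r \<Longrightarrow> u (edge i x) \<ge> u vertex + p i * x + X i / 2 * x\<^sup>2"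
  shows "(\<Sum>i\<in>UNIV. p i) \<ge> 0 \<or> (\<exists>i. F i 0 (u vertex) (p i) (X i) \<ge> 0)"
proof -
  have "(\<Sum>i\<in>UNIV. - p i) \<le> 0 \<or> (\<exists>i. - F i 0 (- (- u vertex)) (- (- p i)) (- (- X i)) \<le> 0)"
  proof (rule quad_sub_vertex[OF assms(1)[unfolded quad_super_def] assms(2)])
    fix i and x :: real assume "x \<le> 0" "\<bar>x\<bar> < r"
    from assms(3)[OF this, of i]
    show "- u (edge i x) \<le> - u vertex + - p i * x + - X i / 2 * x\<^sup>2" by simp
  qed
  then show ?thesis by (simp add: sum_negf)
qed

section \<open>Maxima of coercive families\<close>

lemma continuous_on_edge:
  assumes "continuous_on UNIV u"
  shows "continuous_on {..0} (\<lambda>x. u (edge i x))"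
proof -
  have "1-lipschitz_on {..0} (edge i)"
    by (rule lipschitz_onI) (auto simp: dist_edge dist_real_def)
  then show ?thesis
    using continuous_on_compose2[OF assms lipschitz_on_continuous_on] by blast
qed

text \<open>
  In all applications the domain is unbounded and the maximum is taken over the edges as well.
\<close>

lemma coercive_attains_max:
  fixes f :: "'k::finite \<Rightarrow> 'a::euclidean_space \<Rightarrow> real"
  assumes "closed S" "\<And>i. continuous_on S (f i)" "a0 \<in> S"
    and far: "\<And>i x. x \<in> S \<Longrightarrow> norm x > R \<Longrightarrow> f i x \<le> f i0 a0"
  obtains i x where "x \<in> S" "\<And>j y. y \<in> S \<Longrightarrow> f j y \<le> f i x"
proof -
  define K where "K = S \<inter> cball 0 (max R (norm a0))"
  have "compact K" using assms(1) unfolding K_def by (simp add: closed_Int_compact)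
  have "a0 \<in> K" using assms(3) by (simp add: K_def)
  have "\<exists>x\<in>K. \<forall>y\<in>K. f i y \<le> f i x" for i
    by (rule continuous_attains_sup)
      (use \<open>compact K\<close> \<open>a0 \<in> K\<close> assms(2) in \<open>auto simp: K_def intro: continuous_on_subset\<close>)
  then obtain m where m: "\<And>i. m i \<in> K" "\<And>i y. y \<in> K \<Longrightarrow> f i y \<le> f i (m i)"
    by metis
  obtain i where i: "\<And>j. f j (m j) \<le> f i (m i)"
  proof -
    have "Max (range (\<lambda>j. f j (m j))) \<in> range (\<lambda>j. f j (m j))" by (rule Max_in) auto
    then obtain i where i: "Max (range (\<lambda>j. f j (m j))) = f i (m i)" by (rule rangeE)
    have "f j (m j) \<le> f i (m i)" for j unfolding i[symmetric] by simp
    then show thesis by (rule that)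
  qed
  have inK: "f j y \<le> f i (m i)" if "y \<in> K" for j y
    using m(2)[OF that] i order_trans by blast
  have "f j y \<le> f i (m i)" if "y \<in> S" for j y
  proof (cases "y \<in> K")
    case False
    then have "f j y \<le> f i0 a0" using that by (intro far) (auto simp: K_def)
    then show ?thesis using inK[OF \<open>a0 \<in> K\<close>, of i0] by simp
  qed (rule inK)
  moreover have "m i \<in> S" using m(1) by (simp add: K_def)
  ultimately show thesis by (rule that[rotated])
qed

section \<open>Bounds uniform in the viscosity\<close>

text \<open>
  The test functions \<open>- \<delta> (x + 1)\<^sup>2\<close> tend to \<open>-\<infinity>\<close> along the edges, so they touch the bounded
  function \<open>u\<close> from below; for small \<open>\<delta>\<close> the slope at the contact point is small, while the slopes at
  the vertex stay negative, so that the Kirchhoff alternative cannot occur there. The bound does not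
  depend on \<open>\<epsilon>\<close>.
\<close>

lemma viscous_super_lower_bound:
  fixes u :: "'k::finite junction \<Rightarrow> real"
  assumes "continuous_on UNIV u" "bounded (range u)" "\<epsilon> \<ge> 0"
    and super: "quad_super (\<lambda>i x r p X. r - \<epsilon> * X + H i x p) u"
    and H: "\<And>i x p. x \<le> 0 \<Longrightarrow> \<bar>p\<bar> \<le> 1 \<Longrightarrow> H i x p \<le> B"
  shows "- B - 1 \<le> u z"
proof -
  obtain b where b: "\<And>z. \<bar>u z\<bar> \<le> b" "b > 0"
    using assms(2) unfolding bounded_pos by auto
  obtain i0 z0 where z: "z0 \<le> 0" "z = edge i0 z0" by (rule junction_cases)
  \<comment> \<open>Small enough for the contact slope to be at most \<open>1\<close> and for the viscous term and the value of
    the test function at \<open>z\<close> to contribute at most \<open>1\<close> together.\<close>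
  define \<delta> where "\<delta> = 1 / (2 * \<epsilon> + (z0 + 1)\<^sup>2 + 4 * (2 * b + 2) + 1)"
  have den: "2 * \<epsilon> + (z0 + 1)\<^sup>2 + 4 * (2 * b + 2) + 1 > 0"
    using assms(3) b(2) by (smt (verit) zero_le_power2)
  then have \<delta>: "\<delta> > 0" "\<delta> \<le> 1"
    using assms(3) b(2) by (auto simp: \<delta>_def field_simps)
  have "\<delta> * (2 * \<epsilon> + (z0 + 1)\<^sup>2 + 4 * (2 * b + 2) + 1) = 1"
    using den by (simp add: \<delta>_def)
  then have "2 * \<delta> * \<epsilon> + \<delta> * (z0 + 1)\<^sup>2 + 4 * \<delta> * (2 * b + 2) + \<delta> = 1"
    by (simp only: distrib_left mult.assoc mult.left_commute mult_1_right)
  moreover have "2 * \<delta> * \<epsilon> \<ge> 0" "\<delta> * (z0 + 1)\<^sup>2 \<ge> 0" "4 * \<delta> * (2 * b + 2) \<ge> 0"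
    using \<delta> assms(3) b(2) by auto
  ultimately have small: "2 * \<delta> * \<epsilon> + \<delta> * (z0 + 1)\<^sup>2 \<le> 1" "4 * \<delta> * (2 * b + 2) \<le> 1"
    using \<delta> by linarith+
  define f where "f = (\<lambda>i x. - u (edge i x) - \<delta> * (x + 1)\<^sup>2)"
  have "\<exists>i. \<exists>x\<in>{..0}. \<forall>j. \<forall>y\<in>{..0}. f j y \<le> f i x"
  proof (rule coercive_attains_max[of "{..0}" f 0 "1 + (2 * b + 1) / \<delta>" undefined])
    show "continuous_on {..0} (f i)" for i
      unfolding f_def by (intro continuous_intros continuous_on_edge assms)
    show "f i x \<le> f undefined 0" if "x \<in> {..0}" "norm x > 1 + (2 * b + 1) / \<delta>" for i x
    proof -
      have "x < - 1 - (2 * b + 1) / \<delta>" using that by simp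
      moreover have "(2 * b + 1) / \<delta> \<ge> 1" using \<delta> b(2) by (simp add: field_simps)
      ultimately have "\<bar>x + 1\<bar> \<ge> (2 * b + 1) / \<delta>" "(2 * b + 1) / \<delta> \<ge> 1" by linarith+
      then have "1 * ((2 * b + 1) / \<delta>) \<le> \<bar>x + 1\<bar> * \<bar>x + 1\<bar>" by (intro mult_mono) auto
      then have "(x + 1)\<^sup>2 \<ge> (2 * b + 1) / \<delta>" by (simp add: power2_eq_square)
      then have "\<delta> * (x + 1)\<^sup>2 \<ge> 2 * b + 1" using \<delta> by (simp add: field_simps)
      then show ?thesis
        using b(1)[of "edge i x"] b(1)[of "edge undefined 0"] \<delta> unfolding f_def by simp
    qed
  qed auto
  then obtain i x where x: "x \<le> 0" and max: "\<And>j y. y \<le> 0 \<Longrightarrow> f j y \<le> f i x" by auto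
  have le: "u (edge i x) + \<delta> * (x + 1)\<^sup>2 \<le> u (edge j y) + \<delta> * (y + 1)\<^sup>2" if "y \<le> 0" for j y
    using max[OF that, of j] by (simp add: f_def)
  have p: "\<bar>2 * \<delta> * (x + 1)\<bar> \<le> 1"
  proof -
    have "\<delta> * (x + 1)\<^sup>2 \<le> 2 * b + 2"
      using le[of 0 i] b(1)[of "edge i x"] b(1)[of "edge i 0"] \<delta> by simp
    then have "4 * \<delta> * (\<delta> * (x + 1)\<^sup>2) \<le> 4 * \<delta> * (2 * b + 2)" using \<delta> by (intro mult_left_mono) auto
    also have "\<dots> \<le> 1" by (fact small)
    finally have "(2 * \<delta> * (x + 1))\<^sup>2 \<le> 1" by (simp add: power2_eq_square algebra_simps)
    then show ?thesis by (simp add: abs_square_le_1)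
  qed
  have "u (edge i x) \<ge> - B - 2 * \<delta> * \<epsilon>"
  proof (cases "x = 0")
    case False
    then have "x < 0" using x by simp
    have "u (edge i x) - \<epsilon> * (- 2 * \<delta>) + H i x (- 2 * \<delta> * (x + 1)) \<ge> 0"
    proof (rule quad_super_edge[OF super \<open>x < 0\<close> zero_less_one])
      fix y :: real assume "y \<le> 0"
      then show "u (edge i x) + - 2 * \<delta> * (x + 1) * (y - x) + - 2 * \<delta> / 2 * (y - x)\<^sup>2 \<le> u (edge i y)"
        using le[of y i] by (simp add: power2_eq_square algebra_simps)
    qed
    moreover have "H i x (- 2 * \<delta> * (x + 1)) \<le> B" using p x by (intro H) auto
    ultimately show ?thesis by (simp add: algebra_simps)
  next
    case True
    then have u: "u (edge i x) = u vertex" by simp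
    have "(\<Sum>j\<in>(UNIV :: 'k set). - 2 * \<delta>) \<ge> 0 \<or>
        (\<exists>j. u vertex - \<epsilon> * (- 2 * \<delta>) + H j 0 (- 2 * \<delta>) \<ge> 0)"
    proof (rule quad_super_vertex[OF super zero_less_one])
      fix j and y :: real assume "y \<le> 0"
      then show "u vertex + - 2 * \<delta> * y + - 2 * \<delta> / 2 * y\<^sup>2 \<le> u (edge j y)"
        using le[of y j] True by (simp add: power2_eq_square algebra_simps)
    qed
    then obtain j where "u vertex - \<epsilon> * (- 2 * \<delta>) + H j 0 (- 2 * \<delta>) \<ge> 0"
      using \<delta> by (auto simp: mult_le_0_iff zero_le_mult_iff)
    moreover have "H j 0 (- 2 * \<delta>) \<le> B" using p True by (intro H) auto
    ultimately show ?thesis using u by (simp add: algebra_simps)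
  qed
  then show ?thesis using le[of z0 i0] z small \<delta> by (smt (verit) mult_nonneg_nonneg zero_le_power2)
qed

text \<open>
  A line of slope at least \<open>R\<close> in modulus cannot touch \<open>v\<close> from above inside an edge. Hence \<open>v\<close> cannot grow faster
  than \<open>R\<close> when moving away from the vertex: the line would have to touch, since \<open>v\<close> is bounded. When
  moving towards the vertex the touching could happen at the vertex, where the other edges
  contribute slopes \<open>- R\<close>; the Kirchhoff condition excludes this once the slope exceeds
  \<open>(K - 1) R\<close>, and \<open>K R\<close> does.
\<close>

lemma viscous_sub_Lipschitz:
  fixes v :: "'k::finite junction \<Rightarrow> real" and R :: real
  assumes "continuous_on UNIV v" "bounded (range v)" "R > 0"
    and sub: "quad_sub (\<lambda>i x r p X. r - \<epsilon> * X + H i x p) v"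
    and low: "\<And>z. - B \<le> v z"
    and H: "\<And>i x p. x \<le> 0 \<Longrightarrow> R \<le> \<bar>p\<bar> \<Longrightarrow> B < H i x p"
  shows "(CARD('k) * R)-lipschitz_on UNIV v"
proof -
  define R' where "R' = CARD('k) * R"
  have R': "R' \<ge> R" "R' > (real CARD('k) - 1) * R" "R' > 0"
    using assms(3) by (auto simp: R'_def field_simps Suc_le_eq)
  obtain b where b: "\<And>z. \<bar>v z\<bar> \<le> b" "b > 0"
    using assms(2) unfolding bounded_pos by auto
  have up: "v (edge i y) \<le> v (edge i x0) + R * (x0 - y)" if "y \<le> x0" "x0 \<le> 0" for i and y x0 :: real
  proof (rule ccontr)
    assume "\<not> v (edge i y) \<le> v (edge i x0) + R * (x0 - y)"
    then have gt: "v (edge i y) + R * y > v (edge i x0) + R * x0" by (simp add: algebra_simps)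
    define f where "f = (\<lambda>(_::unit) (x::real). v (edge i x) + R * x)"
    have "\<exists>x\<in>{..x0}. \<forall>z\<in>{..x0}. f () z \<le> f () x"
    proof (rule coercive_attains_max[of "{..x0}" f y "(b - f () y) / R" "()"])
      show "continuous_on {..x0} (f k)" for k
        unfolding f_def
        by (intro continuous_intros continuous_on_subset[OF continuous_on_edge[OF assms(1)]])
          (use that in auto)
      show "f k x \<le> f () y" if "x \<in> {..x0}" "norm x > (b - f () y) / R" for k x
      proof -
        have "- x > (b - f () y) / R" using that \<open>x0 \<le> 0\<close> by simp
        then have "- x * R > b - f () y" using assms(3) by (simp add: field_simps)
        then show ?thesis using b(1)[of "edge i x"] by (simp add: f_def algebra_simps)
      qed
    qed (use that in auto)
    then obtain x where x: "x \<le> x0" and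
      max: "\<And>z. z \<le> x0 \<Longrightarrow> v (edge i z) + R * z \<le> v (edge i x) + R * x"
      by (auto simp: f_def)
    have "x < x0" using max[OF that(1)] gt x by (smt (verit))
    have "v (edge i x) - \<epsilon> * 0 + H i x (- R) \<le> 0"
    proof (rule quad_sub_edge[OF sub])
      show "x < 0" "x0 - x > 0" using \<open>x < x0\<close> that by auto
      show "v (edge i z) \<le> v (edge i x) + - R * (z - x) + 0 / 2 * (z - x)\<^sup>2"
        if "z \<le> 0" "\<bar>z - x\<bar> < x0 - x" for z
        using max[of z] that by (simp add: algebra_simps)
    qed
    moreover have "B < H i x (- R)" using \<open>x < x0\<close> that assms(3) by (intro H) auto
    ultimately show False using low[of "edge i x"] by simp
  qed
  have down: "v (edge i x0) \<le> v (edge i y) + R' * (x0 - y)" if "y \<le> x0" "x0 \<le> 0" for i and y x0 :: real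
  proof (rule ccontr)
    assume "\<not> v (edge i x0) \<le> v (edge i y) + R' * (x0 - y)"
    then have gt: "v (edge i x0) - R' * x0 > v (edge i y) - R' * y" by (simp add: algebra_simps)
    have "\<exists>x\<in>{y..0}. \<forall>z\<in>{y..0}. v (edge i z) - R' * z \<le> v (edge i x) - R' * x"
      by (rule continuous_attains_sup)
        (use that in \<open>auto intro!: continuous_intros continuous_on_subset[OF continuous_on_edge[OF assms(1)]]\<close>)
    then obtain x where x: "y \<le> x" "x \<le> 0" and
      max: "\<And>z. y \<le> z \<Longrightarrow> z \<le> 0 \<Longrightarrow> v (edge i z) - R' * z \<le> v (edge i x) - R' * x"
      by auto
    have "y < x" using max[OF that] gt x by (smt (verit))
    show False
    proof (cases "x = 0")
      case False
      have "v (edge i x) - \<epsilon> * 0 + H i x R' \<le> 0"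
      proof (rule quad_sub_edge[OF sub])
        show "x < 0" "x - y > 0" using \<open>y < x\<close> False x by auto
        show "v (edge i z) \<le> v (edge i x) + R' * (z - x) + 0 / 2 * (z - x)\<^sup>2"
          if "z \<le> 0" "\<bar>z - x\<bar> < x - y" for z
          using max[of z] that by (simp add: algebra_simps)
      qed
      moreover have "B < H i x R'" using x R' assms(3) by (intro H) auto
      ultimately show False using low[of "edge i x"] by simp
    next
      case True
      define p where "p = (\<lambda>j. if j = i then R' else - R)"
      have "(\<Sum>j\<in>UNIV. p j) \<le> 0 \<or> (\<exists>j. v vertex - \<epsilon> * 0 + H j 0 (p j) \<le> 0)"
      proof (rule quad_sub_vertex[OF sub])
        show "- y > 0" using \<open>y < x\<close> True by simp
        show "v (edge j z) \<le> v vertex + p j * z + 0 / 2 * z\<^sup>2"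
          if "z \<le> 0" "\<bar>z\<bar> < - y" for j z
          using max[of z] up[of z 0 j] that True by (auto simp: p_def algebra_simps)
      qed
      moreover have "B < H j 0 (p j)" for j
        using R' assms(3) by (intro H) (auto simp: p_def)
      moreover have "(\<Sum>j\<in>UNIV. p j) = R' - (real CARD('k) - 1) * R"
      proof -
        have "(\<Sum>j\<in>UNIV. p j) = (\<Sum>j\<in>UNIV. - R + (if j = i then R' + R else 0))"
          by (intro sum.cong) (auto simp: p_def)
        also have "\<dots> = - (CARD('k) * R) + (R' + R)"
          by (subst sum.distrib) simp
        finally show ?thesis by (simp add: algebra_simps)
      qed
      ultimately show False using low[of vertex] R' by (smt (verit))
    qed
  qed
  have same: "\<bar>v (edge i x) - v (edge i y)\<bar> \<le> R' * \<bar>x - y\<bar>" if "x \<le> 0" "y \<le> 0" for i x y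
  proof -
    have le: "\<bar>v (edge i x) - v (edge i y)\<bar> \<le> R' * (y - x)" if "x \<le> y" "y \<le> 0" for x y
    proof -
      have "R * (y - x) \<le> R' * (y - x)" using R' that by (intro mult_right_mono) auto
      then show ?thesis using up[OF that, of i] down[OF that, of i] by (simp add: abs_le_iff)
    qed
    show ?thesis using le[of x y] le[of y x] that by (cases "x \<le> y") (auto simp: abs_minus_commute)
  qed
  have "dist (v z) (v w) \<le> R' * dist z w" for z w
  proof -
    obtain i x where z: "x \<le> 0" "z = edge i x" by (rule junction_cases)
    obtain j y where w: "y \<le> 0" "w = edge j y" by (rule junction_cases)
    show ?thesis
    proof (cases "i = j")
      case True
      then show ?thesis using z w same[of x y i] by (simp add: dist_edge dist_real_def)
    next
      case False
      have "\<bar>v z - v w\<bar> \<le> R' * \<bar>x\<bar> + R' * \<bar>y\<bar>"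
        using z w same[of x 0 i] same[of y 0 j] by simp
      then show ?thesis using False z w by (simp add: dist_edge dist_real_def algebra_simps)
    qed
  qed
  then show ?thesis using R' unfolding R'_def[symmetric] by (intro lipschitz_onI) auto
qed

section \<open>Parabolas touching a Lipschitz function from above\<close>

lemma touching_slope_le:
  fixes w :: "real \<Rightarrow> real"
  assumes lip: "\<And>x y. x \<le> 0 \<Longrightarrow> y \<le> 0 \<Longrightarrow> \<bar>w x - w y\<bar> \<le> L * \<bar>x - y\<bar>"
    and "t < 0" "r > 0"
    and touch: "\<And>x. x \<le> 0 \<Longrightarrow> \<bar>x - t\<bar> < r \<Longrightarrow> w x \<le> w t + a * (x - t) + N * (x - t)\<^sup>2"
  shows "\<bar>a\<bar> \<le> L"
proof (rule ccontr)
  assume "\<not> \<bar>a\<bar> \<le> L"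
  define d where "d = (\<bar>a\<bar> - L) / 2"
  define h where "h = min (min (r / 2) (- t)) (d / (\<bar>N\<bar> + 1))"
  have "d > 0" using \<open>\<not> \<bar>a\<bar> \<le> L\<close> by (simp add: d_def)
  then have h: "h > 0" "h < r" "h \<le> - t" "h \<le> d / (\<bar>N\<bar> + 1)"
    using assms(2,3) by (auto simp: h_def)
  have "N * h \<le> (\<bar>N\<bar> + 1) * h" using h(1) by (intro mult_right_mono) auto
  also have "\<dots> \<le> d" using h(4) by (simp add: pos_le_divide_eq mult.commute)
  finally have "N * h \<le> d" .
  then have N: "N * h\<^sup>2 \<le> d * h" using h by (simp add: power2_eq_square mult_right_mono)
  define x where "x = (if a \<ge> 0 then t - h else t + h)"
  have x: "a * (x - t) = - \<bar>a\<bar> * h" "(x - t)\<^sup>2 = h\<^sup>2" "\<bar>x - t\<bar> = h" "x \<le> 0"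
    using h assms(2) by (auto simp: x_def)
  have "- L * h \<le> w x - w t" using lip[of x t] x assms(2) by auto
  also have "\<dots> \<le> - \<bar>a\<bar> * h + N * h\<^sup>2" using touch[of x] x h by auto
  also have "\<dots> \<le> - \<bar>a\<bar> * h + d * h" using N by simp
  finally have "(\<bar>a\<bar> - L - d) * h \<le> 0" by (simp add: algebra_simps)
  then show False using h \<open>d > 0\<close> by (simp add: d_def mult_le_0_iff)
qed

text \<open>
  The slope \<open>s\<close> is the supremum of those for which the parabola stays above \<open>w\<close>.
\<close>

lemma critical_parabola_slope:
  fixes w :: "real \<Rightarrow> real"
  assumes lip: "\<And>x y. x \<le> 0 \<Longrightarrow> y \<le> 0 \<Longrightarrow> \<bar>w x - w y\<bar> \<le> L * \<bar>x - y\<bar>"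
    and "\<eta> > 0" "\<tau> > 0"
  obtains s where "s \<le> L"
    "\<And>x. x \<le> 0 \<Longrightarrow> w x \<le> w 0 + s * x + x\<^sup>2 / (2 * \<eta>)"
    "\<exists>x<0. w 0 + (s + \<tau>) * x + x\<^sup>2 / (2 * \<eta>) < w x"
proof -
  define A where "A = {s. \<forall>x\<le>0. w x \<le> w 0 + s * x + x\<^sup>2 / (2 * \<eta>)}"
  have ne: "- L \<in> A"
    unfolding A_def
  proof (intro CollectI allI impI)
    fix x :: real assume "x \<le> 0"
    have "x\<^sup>2 / (2 * \<eta>) \<ge> 0" using assms(2) by simp
    then show "w x \<le> w 0 + - L * x + x\<^sup>2 / (2 * \<eta>)"
      using lip[OF \<open>x \<le> 0\<close> order_refl] \<open>x \<le> 0\<close> by (simp add: abs_if split: if_splits)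
  qed
  have ub: "s \<le> L" if "s \<in> A" for s
  proof (rule ccontr)
    assume "\<not> s \<le> L"
    \<comment> \<open>The minimum of the parabola relative to the line of slope \<open>L\<close>.\<close>
    define x where "x = - (s - L) * \<eta>"
    have "x < 0" using \<open>\<not> s \<le> L\<close> assms(2) by (simp add: x_def mult_less_0_iff)
    have "x\<^sup>2 / (2 * \<eta>) = - x * (s - L) / 2"
      using assms(2) by (simp add: x_def power2_eq_square field_simps)
    moreover have "w x \<le> w 0 + s * x + x\<^sup>2 / (2 * \<eta>)"
      using that \<open>x < 0\<close> by (simp add: A_def)
    moreover have "w 0 - w x \<le> L * - x" using lip[of 0 x] \<open>x < 0\<close> by auto
    ultimately have "0 \<le> (s - L) * x / 2" by (simp add: field_simps)
    then show False using \<open>x < 0\<close> \<open>\<not> s \<le> L\<close> by (simp add: zero_le_mult_iff)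
  qed
  then have bdd: "bdd_above A" by (rule bdd_aboveI)
  define s where "s = Sup A"
  have "w x \<le> w 0 + s * x + x\<^sup>2 / (2 * \<eta>)" if "x \<le> 0" for x
  proof (cases "x = 0")
    case False
    then have "x < 0" using that by simp
    have "a \<le> (w x - w 0 - x\<^sup>2 / (2 * \<eta>)) / x" if "a \<in> A" for a
    proof -
      have "w x \<le> w 0 + a * x + x\<^sup>2 / (2 * \<eta>)" using that \<open>x < 0\<close> by (simp add: A_def)
      then show ?thesis using \<open>x < 0\<close> by (simp add: neg_le_divide_eq)
    qed
    then have "s \<le> (w x - w 0 - x\<^sup>2 / (2 * \<eta>)) / x"
      unfolding s_def using ne by (intro cSup_least) auto
    then show ?thesis using \<open>x < 0\<close> by (simp add: neg_le_divide_eq)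
  qed simp
  moreover have "s \<le> L" unfolding s_def using ne ub by (intro cSup_least) auto
  moreover have "\<exists>x<0. w 0 + (s + \<tau>) * x + x\<^sup>2 / (2 * \<eta>) < w x"
  proof -
    have "s + \<tau> \<notin> A" using cSup_upper[OF _ bdd, of "s + \<tau>"] assms(3) unfolding s_def by auto
    then obtain x where x: "x \<le> 0" "w 0 + (s + \<tau>) * x + x\<^sup>2 / (2 * \<eta>) < w x"
      by (auto simp: A_def not_le)
    then have "x < 0" by (cases "x = 0") auto
    then show ?thesis using x by blast
  qed
  ultimately show thesis using that by blast
qed

text \<open>
  The parabola of slope \<open>s + \<tau>\<close> at the origin fails to stay above \<open>w\<close>, so the excess of \<open>w\<close> over it
  has a positive maximum, at some \<open>t < 0\<close>. Its slope there is \<open>a = s + \<tau> + t / \<eta>\<close>; since \<open>\<bar>a\<bar> \<le> L\<close> and \<open>s \<le> L\<close>,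
  this also shows that \<open>t\<close> lies within \<open>(2 L + 1) \<eta>\<close> of the origin. The tolerance \<open>\<tau>\<close> keeps \<open>t\<close> away from
  the origin, where the equation on the edge would not be available.
\<close>

lemma parabola_contact_point:
  fixes w :: "real \<Rightarrow> real"
  assumes lip: "\<And>x y. x \<le> 0 \<Longrightarrow> y \<le> 0 \<Longrightarrow> \<bar>w x - w y\<bar> \<le> L * \<bar>x - y\<bar>"
    and "\<eta> > 0" "\<tau> > 0" "\<tau> \<le> 1"
  obtains s t a where
    "\<And>x. x \<le> 0 \<Longrightarrow> w x \<le> w 0 + s * x + x\<^sup>2 / (2 * \<eta>)"
    "t < 0" "- t \<le> (2 * L + 1) * \<eta>" "a \<le> s + \<tau>" "\<bar>a\<bar> \<le> L"
    "\<And>x. x \<le> 0 \<Longrightarrow> w x \<le> w t + a * (x - t) + (x - t)\<^sup>2 / (2 * \<eta>)"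
proof -
  obtain s x0 where s: "s \<le> L" "\<And>x. x \<le> 0 \<Longrightarrow> w x \<le> w 0 + s * x + x\<^sup>2 / (2 * \<eta>)"
    and x0: "x0 < 0" "w 0 + (s + \<tau>) * x0 + x0\<^sup>2 / (2 * \<eta>) < w x0"
    using critical_parabola_slope[of w L \<eta> \<tau>] lip assms(2,3) by metis
  \<comment> \<open>A family with a single member.\<close>
  define f where "f = (\<lambda>(_::unit) x. w x - (s + \<tau>) * x - x\<^sup>2 / (2 * \<eta>))"
  have "L-lipschitz_on {..0} w"
    using lip lip[of 0 "-1"] by (intro lipschitz_onI) (auto simp: dist_real_def)
  then have "continuous_on {..0} w" by (rule lipschitz_on_continuous_on)
  then have cont: "continuous_on {..0} (f k)" for k
    unfolding f_def using assms(2) by (intro continuous_intros) auto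
  have far: "f k x \<le> f () 0" if "x \<in> {..0}" "norm x > 2 * \<eta> * (L + \<bar>s + \<tau>\<bar>)" for k x
  proof -
    have "- x * (2 * \<eta> * (L + \<bar>s + \<tau>\<bar>)) \<le> - x * - x"
      using that by (intro mult_left_mono) auto
    then have "(L + \<bar>s + \<tau>\<bar>) * - x \<le> x\<^sup>2 / (2 * \<eta>)"
      using assms(2) by (simp add: field_simps power2_eq_square)
    moreover have "w x - w 0 \<le> L * - x" using lip[of x 0] that by auto
    moreover have "(s + \<tau>) * - x \<le> \<bar>s + \<tau>\<bar> * - x"
      using that by (intro mult_right_mono) auto
    ultimately show ?thesis by (simp add: f_def algebra_simps)
  qed
  obtain t k where t: "t \<in> {..0}" and max: "\<And>j y. y \<in> {..0} \<Longrightarrow> f j y \<le> f k t"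
    by (rule coercive_attains_max[of "{..0}" f 0 "2 * \<eta> * (L + \<bar>s + \<tau>\<bar>)" "()"])
      (use cont far in auto)
  have max: "w y - (s + \<tau>) * y - y\<^sup>2 / (2 * \<eta>) \<le> w t - (s + \<tau>) * t - t\<^sup>2 / (2 * \<eta>)" if "y \<le> 0" for y
    using max[of y "()"] that by (simp add: f_def)
  have "t < 0"
  proof -
    have "w 0 < w t - (s + \<tau>) * t - t\<^sup>2 / (2 * \<eta>)" using max[of x0] x0 by linarith
    then have "t \<noteq> 0" by auto
    then show ?thesis using t by simp
  qed
  define a where "a = s + \<tau> + t / \<eta>"
  have touch: "w x \<le> w t + a * (x - t) + (x - t)\<^sup>2 / (2 * \<eta>)" if "x \<le> 0" for x
  proof -
    have "a * (x - t) + (x - t)\<^sup>2 / (2 * \<eta>) = (s + \<tau>) * (x - t) + x\<^sup>2 / (2 * \<eta>) - t\<^sup>2 / (2 * \<eta>)"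
      using assms(2) unfolding a_def by (simp add: field_simps power2_eq_square)
    then show ?thesis using max[OF that] by (simp add: algebra_simps)
  qed
  have a: "\<bar>a\<bar> \<le> L"
    using touching_slope_le[of w L t 1 a "1 / (2 * \<eta>)"] lip \<open>t < 0\<close> touch by simp
  have "- t / \<eta> = s + \<tau> - a" by (simp add: a_def)
  also have "\<dots> \<le> 2 * L + 1" using s(1) a assms(4) by linarith
  finally have "- t \<le> (2 * L + 1) * \<eta>" using assms(2) by (simp add: field_simps)
  moreover have "a \<le> s + \<tau>" using \<open>t < 0\<close> assms(2) by (simp add: a_def divide_nonpos_pos)
  ultimately show thesis using that[of s t a] s(2) \<open>t < 0\<close> a touch by blast
qed

section \<open>Subsolutions of the viscous problem\<close>

lemma concave_kink_below_parabola:
  fixes b c N M :: real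
  assumes "c < b"
  shows "\<exists>r>0. \<forall>h. 0 \<le> h \<longrightarrow> h < r \<longrightarrow> - b * h + N * h\<^sup>2 \<le> - c * h - M * h\<^sup>2"
proof (intro exI[of _ "(b - c) / (\<bar>N + M\<bar> + 1)"] conjI allI impI)
  fix h assume h: "0 \<le> h" "h < (b - c) / (\<bar>N + M\<bar> + 1)"
  have pos: "\<bar>N + M\<bar> + 1 > 0" by simp
  have "(N + M) * h \<le> (\<bar>N + M\<bar> + 1) * h" using h(1) by (intro mult_right_mono) auto
  also have "\<dots> \<le> b - c" using h(2) pos by (simp add: pos_less_divide_eq mult.commute)
  finally have "(N + M) * h * h \<le> (b - c) * h" using h(1) by (rule mult_right_mono)
  then show "- b * h + N * h\<^sup>2 \<le> - c * h - M * h\<^sup>2" by (simp add: algebra_simps power2_eq_square)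
qed (use assms in auto)

text \<open>
  If \<open>b > a\<close>, then \<open>v\<close> lies below a concave corner at \<open>t\<close>, and parabolas of intermediate slope and
  arbitrarily negative second derivative touch it there from above; the term \<open>- \<epsilon> v\<^sub>x\<^sub>x\<close> makes
  the equation fail.
\<close>

lemma viscous_sub_no_concave_kink:
  fixes v :: "'k::finite junction \<Rightarrow> real"
  assumes sub: "quad_sub (\<lambda>i x r p X. r - \<epsilon> * X + H i x p) v" and "\<epsilon> > 0"
    and "t < 0" "r > 0"
    and right: "\<And>x. t \<le> x \<Longrightarrow> x \<le> 0 \<Longrightarrow> v (edge i x) \<le> v (edge i t) + a * (x - t) + N * (x - t)\<^sup>2"
    and left: "\<And>x. x \<le> t \<Longrightarrow> v (edge i x) \<le> v (edge i t) + b * (x - t) + N' * (x - t)\<^sup>2"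
  shows "b \<le> a"
proof (rule ccontr)
  assume "\<not> b \<le> a"
  define m where "m = (a + b) / 2"
  have m: "m < b" "- m < - a" using \<open>\<not> b \<le> a\<close> by (auto simp: m_def)
  define M where "M = (\<bar>v (edge i t) + H i t m\<bar> + 1) / (2 * \<epsilon>)"
  have M: "2 * \<epsilon> * M = \<bar>v (edge i t) + H i t m\<bar> + 1" using assms(2) by (simp add: M_def)
  obtain r1 where r1: "r1 > 0" "\<And>h. 0 \<le> h \<Longrightarrow> h < r1 \<Longrightarrow> - b * h + N' * h\<^sup>2 \<le> - m * h - M * h\<^sup>2"
    using concave_kink_below_parabola[OF m(1), of N' M] by blast
  obtain r2 where r2: "r2 > 0" "\<And>h. 0 \<le> h \<Longrightarrow> h < r2 \<Longrightarrow> a * h + N * h\<^sup>2 \<le> m * h - M * h\<^sup>2"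
    using concave_kink_below_parabola[OF m(2), of N M] by auto
  have "v (edge i t) - \<epsilon> * (- 2 * M) + H i t m \<le> 0"
  proof (rule quad_sub_edge[OF sub \<open>t < 0\<close>])
    show "min r1 r2 > 0" using r1 r2 by simp
    fix x :: real assume x: "x \<le> 0" "\<bar>x - t\<bar> < min r1 r2"
    show "v (edge i x) \<le> v (edge i t) + m * (x - t) + - 2 * M / 2 * (x - t)\<^sup>2"
    proof (cases "x \<le> t")
      case True
      then show ?thesis using left[OF True] r1(2)[of "t - x"] x
        by (simp add: power2_commute[of t x] algebra_simps)
    next
      case False
      then show ?thesis using right[of x] r2(2)[of "x - t"] x by (simp add: algebra_simps)
    qed
  qed
  then show False using M by linarith
qed

text \<open>
  Lowering the slopes by \<open>\<delta>\<close> makes room for second derivatives as negative as desired, with which all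
  equations on the edges fail at the vertex; only the Kirchhoff inequality can hold.
\<close>

lemma viscous_sub_vertex_slopes:
  fixes v :: "'k::finite junction \<Rightarrow> real"
  assumes sub: "quad_sub (\<lambda>i x r p X. r - \<epsilon> * X + H i x p) v" and "\<epsilon> > 0"
    and le: "\<And>i x. x \<le> 0 \<Longrightarrow> v (edge i x) \<le> v vertex + s i * x + N * x\<^sup>2"
    and "\<delta> > 0"
  shows "(\<Sum>i\<in>UNIV. s i - \<delta>) \<le> 0"
proof -
  define M where "M = ((\<Sum>i\<in>UNIV. \<bar>v vertex + H i 0 (s i - \<delta>)\<bar>) + 1) / (2 * \<epsilon>)"
  have M: "2 * \<epsilon> * M > \<bar>v vertex + H i 0 (s i - \<delta>)\<bar>" for i
  proof -
    have "\<bar>v vertex + H i 0 (s i - \<delta>)\<bar> \<le> (\<Sum>i\<in>UNIV. \<bar>v vertex + H i 0 (s i - \<delta>)\<bar>)"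
      by (rule member_le_sum) auto
    then show ?thesis using assms(2) by (simp add: M_def)
  qed
  have "\<exists>r>0. \<forall>h. 0 \<le> h \<longrightarrow> h < r \<longrightarrow> - \<delta> * h + N * h\<^sup>2 \<le> - 0 * h - M * h\<^sup>2"
    by (rule concave_kink_below_parabola) (use assms in auto)
  then obtain r where r: "r > 0" "\<And>h. 0 \<le> h \<Longrightarrow> h < r \<Longrightarrow> - \<delta> * h + N * h\<^sup>2 \<le> - M * h\<^sup>2"
    by auto
  have "(\<Sum>i\<in>UNIV. s i - \<delta>) \<le> 0 \<or>
      (\<exists>i. v vertex - \<epsilon> * (- 2 * M) + H i 0 (s i - \<delta>) \<le> 0)"
  proof (rule quad_sub_vertex[OF sub r(1)])
    fix i and x :: real assume "x \<le> 0" "\<bar>x\<bar> < r"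
    then show "v (edge i x) \<le> v vertex + (s i - \<delta>) * x + - 2 * M / 2 * x\<^sup>2"
      using le[of x i] r(2)[of "- x"] by (simp add: algebra_simps)
  qed
  moreover have "\<not> v vertex - \<epsilon> * (- 2 * M) + H i 0 (s i - \<delta>) \<le> 0" for i
    using M[of i] by linarith
  ultimately show ?thesis by blast
qed

section \<open>Doubling the variables edge by edge\<close>

text \<open>
  The tolerance \<open>\<tau>\<close> absorbs everything that tends to zero for fixed \<open>\<epsilon>\<close>: the passage to an interior
  contact point, the strict sign of \<open>\<Sum>\<alpha>\<close>, and the penalty \<open>\<delta> x\<^sup>2\<close> that makes the maximum exist on the
  unbounded edges. Its factor involves the Lipschitz constant \<open>c\<close> of \<open>H\<close> for slopes in
  \<open>[-(L + 1), L + 1]\<close>, which therefore does not enter the rate.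
\<close>

lemma one_sided_estimate_with_tolerance:
  fixes v u :: "'k::finite junction \<Rightarrow> real" and H :: "'k \<Rightarrow> real \<Rightarrow> real \<Rightarrow> real"
  assumes \<eta>: "\<eta> > 0" and L: "L \<ge> 0" and \<Lambda>: "\<Lambda> \<ge> 0" and c: "c \<ge> 0" and \<tau>: "0 < \<tau>" "\<tau> \<le> 1 / 3"
    and sub: "quad_sub (\<lambda>i x r p X. r - \<eta>\<^sup>2 * X + H i x p) v"
    and super: "quad_super (\<lambda>i x r p X. r + H i x p) u"
    and lip: "L-lipschitz_on UNIV v" and cont: "continuous_on UNIV u"
    and bdd: "bounded (range v)" "bounded (range u)"
    and Hx: "\<And>i x y p. x \<le> 0 \<Longrightarrow> y \<le> 0 \<Longrightarrow> \<bar>p\<bar> \<le> L \<Longrightarrow> \<bar>H i x p - H i y p\<bar> \<le> \<Lambda> * \<bar>x - y\<bar>"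
    and Hp: "\<And>i x p q. x \<le> 0 \<Longrightarrow> \<bar>p\<bar> \<le> L + 1 \<Longrightarrow> \<bar>q\<bar> \<le> L + 1 \<Longrightarrow>
        \<bar>H i x p - H i x q\<bar> \<le> c * \<bar>p - q\<bar>"
  shows "v z - u z \<le> (1 + (L + 1)\<^sup>2 / 2 + 3 * L * (2 * L + 1) + \<Lambda> * (4 * L + 3)) * \<eta>
    + (3 * c + \<eta>\<^sup>2 + 1) * \<tau>"
proof -
  define v' where "v' = (\<lambda>i x. v (edge i x))"
  define u' where "u' = (\<lambda>i x. u (edge i x))"
  have v0: "v' i 0 = v vertex" and u0: "u' i 0 = u vertex" for i by (simp_all add: v'_def u'_def)
  have vlip: "\<bar>v' i x - v' i y\<bar> \<le> L * \<bar>x - y\<bar>" if "x \<le> 0" "y \<le> 0" for i x y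
    using lipschitz_onD[OF lip, of "edge i x" "edge i y"] that
    by (simp add: v'_def dist_edge dist_real_def)
  define \<kappa> where "\<kappa> = 1 / (2 * \<eta>)"
  have \<kappa>: "\<kappa> > 0" "2 * \<kappa> * \<eta> = 1" "w / (2 * \<eta>) = \<kappa> * w" for w
    using \<eta> by (auto simp: \<kappa>_def)
  have \<kappa>_cancel: "\<eta> * (2 * \<kappa> * w) = w" for w
    using \<kappa>(2) by (metis mult.assoc mult.commute mult_1)

  have "\<exists>s t a. (\<forall>x\<le>0. v' i x \<le> v' i 0 + s * x + x\<^sup>2 / (2 * \<eta>)) \<and>
      t < 0 \<and> - t \<le> (2 * L + 1) * \<eta> \<and> a \<le> s + \<tau> \<and> \<bar>a\<bar> \<le> L \<and>
      (\<forall>x\<le>0. v' i x \<le> v' i t + a * (x - t) + (x - t)\<^sup>2 / (2 * \<eta>))" for i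
  proof -
    have "\<tau> \<le> 1" using \<tau> by simp
    show ?thesis
      by (rule parabola_contact_point[of "v' i" L \<eta> \<tau>, OF vlip \<eta> \<tau>(1) \<open>\<tau> \<le> 1\<close>]) blast+
  qed
  then obtain s t a where
    s: "\<And>i x. x \<le> 0 \<Longrightarrow> v' i x \<le> v vertex + s i * x + \<kappa> * x\<^sup>2"
    and t: "\<And>i. t i < 0" "\<And>i. - t i \<le> (2 * L + 1) * \<eta>"
    and a: "\<And>i. a i \<le> s i + \<tau>" "\<And>i. \<bar>a i\<bar> \<le> L"
    and touch: "\<And>i x. x \<le> 0 \<Longrightarrow> v' i x \<le> v' i (t i) + a i * (x - t i) + \<kappa> * (x - t i)\<^sup>2"
    unfolding \<kappa>(3) v0 by metis
  have Lt: "L * - t i \<le> L * ((2 * L + 1) * \<eta>)" for i using t(2) L by (rule mult_left_mono)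
  have contact: "v' i (t i) + H i (t i) (a i) \<le> \<eta> + \<eta>\<^sup>2 * \<tau>" for i
  proof -
    have "v' i (t i) - \<eta>\<^sup>2 * (2 * \<kappa>) + H i (t i) (a i) \<le> 0"
      unfolding v'_def
      by (rule quad_sub_edge[OF sub t(1) zero_less_one])
        (use touch in \<open>simp add: v'_def\<close>)
    moreover have "\<eta>\<^sup>2 * (2 * \<kappa>) = \<eta>" using \<kappa>(2) by (simp add: power2_eq_square algebra_simps)
    moreover have "\<eta>\<^sup>2 * \<tau> \<ge> 0" using \<tau>(1) by simp
    ultimately show ?thesis by linarith
  qed
  \<comment> \<open>The sum of the \<open>a i\<close> may be as large as \<open>2 \<tau>\<close> per edge, so lowering them by \<open>3 \<tau>\<close> makes it negative;
    \<open>\<alpha> i < a i\<close> also excludes the maxima with \<open>x < 0\<close> and \<open>y = 0\<close>.\<close>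
  define \<alpha> where "\<alpha> = (\<lambda>i. a i - 3 * \<tau>)"
  have \<alpha>: "\<bar>\<alpha> i\<bar> \<le> L + 3 * \<tau>" "\<bar>\<alpha> i\<bar> \<le> L + 1" for i
    using a(2)[of i] \<tau> by (auto simp: \<alpha>_def)
  have slopes: "(\<Sum>i\<in>UNIV. \<alpha> i) < 0"
  proof -
    have "(\<Sum>i\<in>UNIV. \<alpha> i) < (\<Sum>i\<in>UNIV. s i - \<tau>)"
    proof (rule sum_strict_mono)
      show "\<alpha> j < s j - \<tau>" for j using a(1)[of j] \<tau>(1) by (simp add: \<alpha>_def)
    qed auto
    also have "\<dots> \<le> 0"
      by (rule viscous_sub_vertex_slopes[OF sub, of s \<kappa>])
        (use s \<eta> \<tau>(1) in \<open>auto simp: v'_def\<close>)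
    finally show ?thesis .
  qed

  obtain b1 where b1: "\<And>z. \<bar>v z\<bar> \<le> b1" using bdd(1) unfolding bounded_iff by auto
  obtain b2 where b2: "\<And>z. \<bar>u z\<bar> \<le> b2" using bdd(2) unfolding bounded_iff by auto
  define b where "b = max b1 b2"
  have b: "\<bar>v z\<bar> \<le> b" "\<bar>u z\<bar> \<le> b" for z
    using b1[of z] b2[of z] by (auto simp: b_def)
  then have b0: "b \<ge> 0" using abs_ge_zero order_trans by blast
  define Q where "Q = 6 * b + \<eta> * (L + 1)\<^sup>2"
  have Q: "Q \<ge> 0" using b0 \<eta> by (simp add: Q_def)
  obtain k0 z0 where z: "z0 \<le> 0" "z = edge k0 z0" by (rule junction_cases)
  \<comment> \<open>So small that at a maximum the slope \<open>2 \<delta> x\<close> of the penalty is at most \<open>\<tau>\<close> in modulus, and so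
    is its value at the given point \<open>z\<close>.\<close>
  define \<delta> where "\<delta> = min (\<tau> / 2) (min (\<tau>\<^sup>2 / (4 * Q + 1)) (\<tau> / (z0\<^sup>2 + 1)))"
  have \<delta>: "\<delta> > 0" "2 * \<delta> \<le> \<tau>" "4 * \<delta> * Q \<le> \<tau>\<^sup>2" "\<delta> * z0\<^sup>2 \<le> \<tau>"
  proof -
    have pos: "z0\<^sup>2 + 1 > 0" by (simp add: add_nonneg_pos)
    show d: "\<delta> > 0" using \<tau>(1) Q pos by (simp add: \<delta>_def)
    show "2 * \<delta> \<le> \<tau>" by (simp add: \<delta>_def)
    have "\<delta> \<le> \<tau>\<^sup>2 / (4 * Q + 1)" by (simp add: \<delta>_def)
    then have "\<delta> * (4 * Q + 1) \<le> \<tau>\<^sup>2" using Q by (simp add: pos_le_divide_eq)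
    then show "4 * \<delta> * Q \<le> \<tau>\<^sup>2" using d by (simp add: algebra_simps)
    have "\<delta> \<le> \<tau> / (z0\<^sup>2 + 1)" by (simp add: \<delta>_def)
    then have "\<delta> * (z0\<^sup>2 + 1) \<le> \<tau>" using pos by (simp add: pos_le_divide_eq)
    then show "\<delta> * z0\<^sup>2 \<le> \<tau>" using d by (simp add: algebra_simps)
  qed

  \<comment> \<open>The layer between \<open>t i\<close> and the vertex is cut off and the rest reattached at the value of \<open>v\<close> at
    the vertex.\<close>
  define V where "V = (\<lambda>i x. v' i (x + t i) - v' i (t i) + v vertex)"
  define \<Psi> where "\<Psi> = (\<lambda>i (x, y). V i x - u' i y - \<alpha> i * (x - y) - \<kappa> * (x - y)\<^sup>2 - \<delta> * x\<^sup>2)"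
  have V0: "V i 0 = v vertex" for i by (simp add: V_def)
  have \<Psi>0: "\<Psi> i (0, 0) = v vertex - u vertex" for i by (simp add: \<Psi>_def V0 u0)
  have \<alpha>_sq: "(\<alpha> i)\<^sup>2 \<le> (L + 1)\<^sup>2" for i
    using power_mono[OF \<alpha>(2)[of i] abs_ge_zero, of 2] by simp
  \<comment> \<open>Completing the square shows that the tilt costs only \<open>O(\<eta>)\<close>; half of the quadratic term can
    even be kept, which gives coercivity in \<open>x - y\<close>.\<close>
  have square: "- \<alpha> i * d - \<kappa> * d\<^sup>2 \<le> \<eta> * (L + 1)\<^sup>2 / 2" for i d
  proof -
    have "2 * \<kappa> * (- \<alpha> i * d - \<kappa> * d\<^sup>2) = \<alpha> i ^ 2 / 2 - 2 * (\<kappa> * d + \<alpha> i / 2)\<^sup>2"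
      by (simp add: power2_eq_square field_simps)
    also have "\<dots> \<le> (L + 1)\<^sup>2 / 2" using \<alpha>_sq[of i] zero_le_power2[of "\<kappa> * d + \<alpha> i / 2"] by linarith
    finally have "\<eta> * (2 * \<kappa> * (- \<alpha> i * d - \<kappa> * d\<^sup>2)) \<le> \<eta> * ((L + 1)\<^sup>2 / 2)"
      using \<eta> by (intro mult_left_mono) auto
    then show ?thesis unfolding \<kappa>_cancel by simp
  qed
  have square': "- \<alpha> i * d - \<kappa> * d\<^sup>2 \<le> \<eta> * (L + 1)\<^sup>2 - \<kappa> / 2 * d\<^sup>2" for i d
  proof -
    have "2 * \<kappa> * (- \<alpha> i * d - \<kappa> * d\<^sup>2) = \<alpha> i ^ 2 - (\<kappa> * d + \<alpha> i)\<^sup>2 - 2 * \<kappa> * (\<kappa> / 2 * d\<^sup>2)"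
      by (simp add: power2_eq_square field_simps)
    also have "\<dots> \<le> (L + 1)\<^sup>2 - 2 * \<kappa> * (\<kappa> / 2 * d\<^sup>2)"
      using \<alpha>_sq[of i] zero_le_power2[of "\<kappa> * d + \<alpha> i"] by linarith
    finally have "\<eta> * (2 * \<kappa> * (- \<alpha> i * d - \<kappa> * d\<^sup>2)) \<le> \<eta> * ((L + 1)\<^sup>2 - 2 * \<kappa> * (\<kappa> / 2 * d\<^sup>2))"
      using \<eta> by (intro mult_left_mono) auto
    then show ?thesis unfolding right_diff_distrib[of \<eta>] \<kappa>_cancel by simp
  qed
  have \<Psi>_le: "\<Psi> i (x, y) \<le> - 2 * b + Q - \<kappa> / 2 * (x - y)\<^sup>2 - \<delta> * x\<^sup>2" for i x y
  proof -
    have "V i x - u' i y \<le> 4 * b"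
      using b(1)[of "edge i (x + t i)"] b(1)[of "edge i (t i)"] b(1)[of vertex] b(2)[of "edge i y"]
      unfolding V_def v'_def u'_def by linarith
    then show ?thesis using square'[of i "x - y"] unfolding \<Psi>_def Q_def by simp
  qed
  obtain p i where p: "p \<in> {..0} \<times> {..0}" and
    pmax: "\<And>j w. w \<in> {..0} \<times> {..0} \<Longrightarrow> \<Psi> j w \<le> \<Psi> i p"
  proof (rule coercive_attains_max[of "{..0} \<times> {..0}" \<Psi> "(0, 0)" "1 + 3 * Q / min (\<kappa> / 2) \<delta>" undefined])
    show "closed ({..0::real} \<times> {..0::real})" by (intro closed_Times closed_atMost)
    have v'_cont: "continuous_on {..0} (v' j)" for j
      unfolding v'_def using continuous_on_edge[OF lipschitz_on_continuous_on[OF lip]] .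
    have "continuous_on {..0} (V j)" for j
      unfolding V_def using t(1)[of j]
      by (intro continuous_intros continuous_on_compose2[OF v'_cont]) auto
    moreover have "continuous_on {..0} (u' j)" for j
      unfolding u'_def by (rule continuous_on_edge[OF cont])
    ultimately show "continuous_on ({..0} \<times> {..0}) (\<Psi> j)" for j
      unfolding \<Psi>_def case_prod_beta
      by (intro continuous_intros continuous_on_compose2[of "{..0}" "V j" _ fst]
          continuous_on_compose2[of "{..0}" "u' j" _ snd]) auto
    show "\<Psi> j w \<le> \<Psi> undefined (0, 0)"
      if w: "w \<in> {..0} \<times> {..0}" "norm w > 1 + 3 * Q / min (\<kappa> / 2) \<delta>" for j w
    proof -
      obtain x y where xy: "w = (x, y)" by (cases w)
      define m where "m = min (\<kappa> / 2) \<delta>"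
      have m: "m > 0" "m \<le> \<kappa> / 2" "m \<le> \<delta>" using \<kappa>(1) \<delta>(1) by (auto simp: m_def)
      have "3 * Q / m \<ge> 0" using Q m by simp
      then have "norm w > 1" "norm w \<ge> 3 * Q / m" using w(2) unfolding m_def[symmetric] by linarith+
      then have "3 * Q / m * 1 \<le> norm w * norm w" by (intro mult_mono) auto
      then have "3 * Q / m \<le> x\<^sup>2 + y\<^sup>2"
        unfolding power2_eq_square[symmetric] by (simp add: xy norm_Pair)
      also have "\<dots> \<le> 3 * ((x - y)\<^sup>2 + x\<^sup>2)"
      proof -
        have "0 \<le> (2 * x - y)\<^sup>2 + (x - y)\<^sup>2 " by simp
        moreover have "3 * ((x - y)\<^sup>2 + x\<^sup>2) - (x\<^sup>2 + y\<^sup>2) = (2 * x - y)\<^sup>2 + (x - y)\<^sup>2"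
          by (simp add: power2_eq_square algebra_simps)
        ultimately show ?thesis by linarith
      qed
      finally have "Q \<le> m * (x - y)\<^sup>2 + m * x\<^sup>2" using m(1) by (simp add: field_simps)
      also have "\<dots> \<le> \<kappa> / 2 * (x - y)\<^sup>2 + \<delta> * x\<^sup>2"
        using m by (intro add_mono mult_right_mono) auto
      finally have "\<Psi> j w \<le> - 2 * b" using \<Psi>_le[of j x y] xy by simp
      then show ?thesis using b(1)[of vertex] b(2)[of vertex] \<Psi>0 by (simp add: abs_le_iff)
    qed
  qed (use that in auto)
  obtain x y where xy: "p = (x, y)" by (cases p)
  have x: "x \<le> 0" and y: "y \<le> 0" using p xy by auto
  have max: "\<Psi> j (x', y') \<le> \<Psi> i (x, y)" if "x' \<le> 0" "y' \<le> 0" for j x' y'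
    using pmax[of "(x', y')" j] that xy by simp

  have \<delta>x: "\<bar>2 * \<delta> * x\<bar> \<le> \<tau>"
  proof -
    have "\<delta> * x\<^sup>2 \<le> Q"
    proof -
      have "- 2 * b \<le> \<Psi> i (x, y)"
        using max[of 0 0 i] \<Psi>0[of i] b(1)[of vertex] b(2)[of vertex] by (simp add: abs_le_iff)
      moreover have "\<kappa> / 2 * (x - y)\<^sup>2 \<ge> 0" using \<kappa>(1) by simp
      ultimately show ?thesis using \<Psi>_le[of i x y] by linarith
    qed
    then have "4 * \<delta> * (\<delta> * x\<^sup>2) \<le> 4 * \<delta> * Q" using \<delta>(1) by (intro mult_left_mono) auto
    then have "(2 * \<delta> * x)\<^sup>2 \<le> \<tau>\<^sup>2" using \<delta>(3) by (simp add: power2_eq_square algebra_simps)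
    then show ?thesis using \<tau>(1) by (simp add: abs_le_square_iff[symmetric])
  qed
  define E where "E = \<eta> + \<Lambda> * ((4 * L + 3) * \<eta>) + (3 * c + \<eta>\<^sup>2) * \<tau>"
  have compare: "v' j x' - u' j y' \<le> E"
    if "v' j x' + H j x' p \<le> \<eta> + \<eta>\<^sup>2 * \<tau>" "0 \<le> u' j y' + H j y' q"
      "x' \<le> 0" "y' \<le> 0" "\<bar>p\<bar> \<le> L" "\<bar>q\<bar> \<le> L + 1" "\<bar>q - p\<bar> \<le> 3 * \<tau>" "\<bar>x' - y'\<bar> \<le> (4 * L + 3) * \<eta>"
    for j x' y' p q
  proof -
    have "\<bar>H j y' q - H j y' p\<bar> \<le> c * (3 * \<tau>)"
      using Hp[of y' q p j] that mult_left_mono[OF that(7) c] by simp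
    moreover have "\<bar>H j x' p - H j y' p\<bar> \<le> \<Lambda> * ((4 * L + 3) * \<eta>)"
      using Hx[of x' y' p j] that mult_left_mono[OF that(8) \<Lambda>] by simp
    ultimately show ?thesis
      using that(1,2) unfolding E_def distrib_right by linarith
  qed
  have u_test: "u' i y' \<ge> u' i y + (\<alpha> i + 2 * \<kappa> * (x - y)) * (y' - y) + - 2 * \<kappa> / 2 * (y' - y)\<^sup>2"
    if "y' \<le> 0" for y'
    using max[OF x that, of i] by (simp add: \<Psi>_def power2_eq_square algebra_simps)
  have v_test: "v' i \<xi> \<le> v' i (x + t i) + (\<alpha> i + 2 * \<kappa> * (x - y) + 2 * \<delta> * x) * (\<xi> - (x + t i))
      + (2 * \<kappa> + 2 * \<delta>) / 2 * (\<xi> - (x + t i))\<^sup>2" if "\<xi> \<le> t i" for \<xi>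
  proof -
    define h where "h = \<xi> - (x + t i)"
    have \<xi>: "\<xi> - t i = x + h" "\<xi> - (x + t i) = h" "\<xi> = x + h + t i" by (auto simp: h_def)
    have "\<Psi> i (x + h, y) \<le> \<Psi> i (x, y)" using max[of "\<xi> - t i" y i] that y \<xi> by simp
    moreover have half: "(2 * \<kappa> + 2 * \<delta>) / 2 = \<kappa> + \<delta>" by simp
    ultimately show ?thesis unfolding \<xi>(2) half unfolding \<xi>(3)
      by (simp add: \<Psi>_def V_def power2_eq_square algebra_simps)
  qed
  have key: "\<Psi> i (x, y) \<le> E + \<eta> * (L + 1)\<^sup>2 / 2 + L * ((2 * L + 1) * \<eta>)"
  proof -
    have reduce: ?thesis if "v' i (x + t i) - u' i y \<le> E"
    proof -
      have "V i x \<le> v' i (x + t i) + L * ((2 * L + 1) * \<eta>)"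
        using vlip[of 0 "t i" i] v0[of i] t(1)[of i] Lt[of i] unfolding V_def by simp
      moreover have "\<delta> * x\<^sup>2 \<ge> 0" using \<delta>(1) by simp
      ultimately show ?thesis
        using that square[of i "x - y"] unfolding \<Psi>_def by simp
    qed
    consider "x < 0" "y < 0" | "x < 0" "y = 0" | "x = 0" "y < 0" | "x = 0" "y = 0"
      using x y by linarith
    then show ?thesis
    proof cases
      case 1
      define p where "p = \<alpha> i + 2 * \<kappa> * (x - y) + 2 * \<delta> * x"
      define q where "q = \<alpha> i + 2 * \<kappa> * (x - y)"
      have xt: "x + t i < 0" "x + t i < t i" using 1 t(1)[of i] by auto
      have p: "\<bar>p\<bar> \<le> L"
      proof (rule touching_slope_le[of "v' i" L "x + t i" "- x" p "(2 * \<kappa> + 2 * \<delta>) / 2", OF vlip xt(1)])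
        fix \<xi> assume "\<bar>\<xi> - (x + t i)\<bar> < - x"
        then show "v' i \<xi> \<le> v' i (x + t i) + p * (\<xi> - (x + t i))
            + (2 * \<kappa> + 2 * \<delta>) / 2 * (\<xi> - (x + t i))\<^sup>2"
          unfolding p_def by (intro v_test) auto
      qed (use 1 in auto)
      have qp: "\<bar>q - p\<bar> \<le> \<tau>" using \<delta>x by (simp add: p_def q_def)
      have "v' i (x + t i) - \<eta>\<^sup>2 * (2 * \<kappa> + 2 * \<delta>) + H i (x + t i) p \<le> 0"
        unfolding v'_def
      proof (rule quad_sub_edge[OF sub xt(1), of "- x"])
        fix \<xi> assume "\<bar>\<xi> - (x + t i)\<bar> < - x"
        then show "v (edge i \<xi>) \<le> v (edge i (x + t i)) + p * (\<xi> - (x + t i))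
            + (2 * \<kappa> + 2 * \<delta>) / 2 * (\<xi> - (x + t i))\<^sup>2"
          using v_test[of \<xi>] unfolding p_def v'_def by auto
      qed (use 1 in auto)
      moreover have "\<eta>\<^sup>2 * (2 * \<kappa> + 2 * \<delta>) \<le> \<eta> + \<eta>\<^sup>2 * \<tau>"
      proof -
        have "\<eta>\<^sup>2 * (2 * \<kappa> + 2 * \<delta>) = \<eta> * (2 * \<kappa> * \<eta>) + \<eta>\<^sup>2 * (2 * \<delta>)"
          by (simp add: power2_eq_square algebra_simps)
        also have "\<dots> \<le> \<eta> + \<eta>\<^sup>2 * \<tau>" using \<kappa>(2) \<delta>(2) by (simp add: mult_left_mono)
        finally show ?thesis .
      qed
      ultimately have v_ineq: "v' i (x + t i) + H i (x + t i) p \<le> \<eta> + \<eta>\<^sup>2 * \<tau>" by linarith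
      have u_ineq: "0 \<le> u' i y + H i y q"
        unfolding u'_def
        by (rule quad_super_edge[OF super 1(2) zero_less_one, of _ _ "- 2 * \<kappa>"])
          (use u_test in \<open>simp add: u'_def q_def\<close>)
      have "x - y = \<eta> * (q - \<alpha> i)"
        unfolding q_def add_diff_cancel_left' \<kappa>_cancel by simp
      moreover have "\<bar>q - \<alpha> i\<bar> \<le> 2 * L + 2" using p qp \<alpha>(1)[of i] \<tau> by linarith
      ultimately have "\<bar>x - y\<bar> \<le> \<eta> * (2 * L + 2)" using \<eta> by (simp add: abs_mult mult_left_mono)
      then have "\<bar>x + t i - y\<bar> \<le> (4 * L + 3) * \<eta>"
        using t(1)[of i] t(2)[of i] by (simp add: algebra_simps)
      then show ?thesis
        using v_ineq u_ineq xt(1) y p qp \<tau> by (intro reduce compare[of i _ p _ q]) auto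
    next
      case 2
      have "V i x \<le> v vertex + a i * x + \<kappa> * x\<^sup>2"
        using touch[of "x + t i" i] 2 t(1)[of i] by (simp add: V_def)
      then have "\<Psi> i (x, 0) \<le> v vertex - u vertex + 3 * \<tau> * x - \<delta> * x\<^sup>2"
        by (simp add: \<Psi>_def u0 \<alpha>_def algebra_simps)
      moreover have "3 * \<tau> * x < 0" "\<delta> * x\<^sup>2 \<ge> 0" using 2 \<tau>(1) \<delta>(1) by (auto simp: mult_pos_neg)
      moreover have "\<Psi> i (0, 0) \<le> \<Psi> i (x, 0)" using max[of 0 0 i] 2 by simp
      ultimately show ?thesis using \<Psi>0[of i] by linarith
    next
      case 3
      define q where "q = \<alpha> i + 2 * \<kappa> * (0 - y)"
      \<comment> \<open>The contact point \<open>t i\<close> lies inside the edge: the test function touches \<open>v\<close> on its left, the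
        parabola of slope \<open>a i\<close> on its right.\<close>
      have "q \<le> a i"
      proof (rule viscous_sub_no_concave_kink[OF sub _ t(1)[of i] zero_less_one])
        show "v (edge i \<xi>) \<le> v (edge i (t i)) + q * (\<xi> - t i) + (2 * \<kappa> + 2 * \<delta>) / 2 * (\<xi> - t i)\<^sup>2"
          if "\<xi> \<le> t i" for \<xi>
          using v_test[OF that] 3 by (simp add: v'_def q_def)
        show "v (edge i \<xi>) \<le> v (edge i (t i)) + a i * (\<xi> - t i) + \<kappa> * (\<xi> - t i)\<^sup>2" if "\<xi> \<le> 0" for \<xi>
          using touch[OF that, of i] by (simp add: v'_def)
      qed (use \<eta> in auto)
      moreover have "q > \<alpha> i" using 3 \<kappa>(1) by (simp add: q_def mult_pos_neg)
      ultimately have q: "\<bar>q - a i\<bar> \<le> 3 * \<tau>" "\<bar>q\<bar> \<le> L + 1" "\<bar>q - \<alpha> i\<bar> \<le> 1"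
        using a(2)[of i] \<tau> by (auto simp: \<alpha>_def)
      have u_ineq: "0 \<le> u' i y + H i y q"
        unfolding u'_def
        by (rule quad_super_edge[OF super 3(2) zero_less_one, of _ _ "- 2 * \<kappa>"])
          (use u_test 3 in \<open>simp add: u'_def q_def\<close>)
      have "- y = \<eta> * (q - \<alpha> i)"
        unfolding q_def add_diff_cancel_left' \<kappa>_cancel by simp
      moreover have "\<eta> * (q - \<alpha> i) \<le> \<eta> * 1" using \<eta> q(3) by (intro mult_left_mono) auto
      ultimately have "\<bar>y\<bar> \<le> \<eta>" using 3 by linarith
      moreover have "0 \<le> L * \<eta>" using L \<eta> by simp
      ultimately have "\<bar>t i - y\<bar> \<le> (4 * L + 3) * \<eta>"
        using t(1)[of i] t(2)[of i] \<eta> by (simp add: algebra_simps)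
      then have "v' i (t i) - u' i y \<le> E"
        using contact[of i] u_ineq q a(2)[of i] t(1)[of i] y by (intro compare[of i _ "a i" _ q]) auto
      then show ?thesis using 3 by (intro reduce) simp
    next
      case 4
      have "(\<Sum>j\<in>UNIV. \<alpha> j) \<ge> 0 \<or> (\<exists>j. u vertex + H j 0 (\<alpha> j) \<ge> 0)"
      proof (rule quad_super_vertex[OF super zero_less_one])
        fix j and y' :: real assume "y' \<le> 0"
        then show "u vertex + \<alpha> j * y' + - 2 * \<kappa> / 2 * y'\<^sup>2 \<le> u (edge j y')"
          using max[of 0 y' j] 4 \<Psi>0[of i] by (simp add: \<Psi>_def V0 u'_def)
      qed
      then obtain j where j: "u vertex + H j 0 (\<alpha> j) \<ge> 0" using slopes by auto
      have "0 \<le> L * \<eta>" using L \<eta> by simp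
      then have "\<bar>t j - 0\<bar> \<le> (4 * L + 3) * \<eta>"
        using t(1)[of j] t(2)[of j] \<eta> by (simp add: algebra_simps)
      then have "v' j (t j) - u' j 0 \<le> E"
        using contact[of j] j a(2)[of j] t(1)[of j] \<alpha>(2)[of j] \<tau>(1)
        by (intro compare[of j _ "a j" _ "\<alpha> j"]) (auto simp: u0 \<alpha>_def)
      moreover have "v vertex \<le> v' j (t j) + L * ((2 * L + 1) * \<eta>)"
        using vlip[of 0 "t j" j] v0[of j] t(1)[of j] Lt[of j] by simp
      moreover have "\<eta> * (L + 1)\<^sup>2 / 2 \<ge> 0" using \<eta> by simp
      ultimately show ?thesis using 4 \<Psi>0[of i] u0[of j] by simp
    qed
  qed
  have "v z \<le> V k0 z0 + 2 * (L * ((2 * L + 1) * \<eta>))"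
    using vlip[of z0 "z0 + t k0" k0] vlip[of "t k0" 0 k0] v0[of k0] t(1)[of k0] Lt[of k0] z
    by (simp add: V_def v'_def)
  moreover have "V k0 z0 - u z - \<tau> \<le> \<Psi> k0 (z0, z0)"
    using \<delta>(4) z by (simp add: \<Psi>_def u'_def)
  moreover have "\<Psi> k0 (z0, z0) \<le> \<Psi> i (x, y)" using max z by simp
  ultimately have "v z - u z \<le> E + \<eta> * (L + 1)\<^sup>2 / 2 + 3 * (L * ((2 * L + 1) * \<eta>)) + \<tau>"
    using key by linarith
  also have "\<dots> = (1 + (L + 1)\<^sup>2 / 2 + 3 * L * (2 * L + 1) + \<Lambda> * (4 * L + 3)) * \<eta>
    + (3 * c + \<eta>\<^sup>2 + 1) * \<tau>"
    unfolding E_def by (simp add: field_simps)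
  finally show ?thesis .
qed

section \<open>Lipschitz constants\<close>

lemma Lipschitz_on_strips_uniform:
  fixes H :: "'k::finite \<Rightarrow> real \<Rightarrow> real \<Rightarrow> real"
  assumes "Lipschitz_on_strips H" "R > 0"
  obtains c where "c \<ge> 0" "\<And>i. c-lipschitz_on ({..0} \<times> {-R..R}) (\<lambda>(x, p). H i x p)"
proof -
  have "\<forall>i. \<exists>c. c-lipschitz_on ({..0} \<times> {-R..R}) (\<lambda>(x, p). H i x p)"
    using assms unfolding Lipschitz_on_strips_def by blast
  from choice[OF this]
  obtain d where "\<forall>i. (d i)-lipschitz_on ({..0} \<times> {-R..R}) (\<lambda>(x, p). H i x p)" ..
  then have d: "(d i)-lipschitz_on ({..0} \<times> {-R..R}) (\<lambda>(x, p). H i x p)" for i ..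
  have d0: "d i \<ge> 0" for i using d[of i] by (rule lipschitz_on_nonneg)
  have "d i \<le> (\<Sum>i\<in>UNIV. d i)" for i by (rule member_le_sum) (auto simp: d0)
  then have "(\<Sum>i\<in>UNIV. d i)-lipschitz_on ({..0} \<times> {-R..R}) (\<lambda>(x, p). H i x p)" for i
    by (rule lipschitz_on_le[OF d[of i]])
  moreover have "(\<Sum>i\<in>UNIV. d i) \<ge> 0" by (simp add: d0 sum_nonneg)
  ultimately show thesis by (rule that[rotated])
qed

lemma lipschitz_strip_slope:
  fixes h :: "real \<Rightarrow> real \<Rightarrow> real"
  assumes "c-lipschitz_on ({..0} \<times> {-R..R}) (\<lambda>(x, p). h x p)"
    and "x \<le> 0" "\<bar>p\<bar> \<le> R" "\<bar>q\<bar> \<le> R"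
  shows "\<bar>h x p - h x q\<bar> \<le> c * \<bar>p - q\<bar>"
  using lipschitz_onD[OF assms(1), of "(x, p)" "(x, q)"] assms(2-4)
  by (simp add: dist_Pair_Pair dist_real_def abs_le_iff)

lemma Lip_on_le_iff_lipschitz_on:
  assumes "C \<ge> 0" shows "Lip_on S f \<le> ennreal C \<longleftrightarrow> C-lipschitz_on S f"
proof
  assume le: "Lip_on S f \<le> ennreal C"
  show "C-lipschitz_on S f"
  proof (rule lipschitz_onI)
    fix x y assume xy: "x \<in> S" "y \<in> S"
    show "dist (f x) (f y) \<le> C * dist x y"
    proof (cases "x = y")
      case False
      then have "ennreal (dist (f x) (f y) / dist x y) \<le> Lip_on S f"
        unfolding Lip_on_def using xy by (intro SUP_upper2[of x] SUP_upper) auto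
      then have "ennreal (dist (f x) (f y) / dist x y) \<le> ennreal C" using le by (rule order_trans)
      then have "dist (f x) (f y) / dist x y \<le> C" using assms by simp
      then show ?thesis using False by (simp add: divide_le_eq)
    qed simp
  qed (rule assms)
next
  assume lip: "C-lipschitz_on S f"
  show "Lip_on S f \<le> ennreal C"
    unfolding Lip_on_def
  proof (intro SUP_least)
    fix x y assume "x \<in> S" "y \<in> S - {x}"
    then show "ennreal (dist (f x) (f y) / dist x y) \<le> ennreal C"
      using lipschitz_onD[OF lip, of x y] assms by (intro ennreal_leI) (simp add: divide_le_eq)
  qed
qed

section \<open>The rate of convergence\<close>

lemma viscous_solutions_equi_Lipschitz:
  fixes H :: "'k::finite \<Rightarrow> real \<Rightarrow> real \<Rightarrow> real"
  assumes "Lipschitz_on_strips H" "uniformly_coercive H" "bounded_at_zero H"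
  obtains C where "C \<ge> 0" "\<And>\<epsilon> v. \<epsilon> \<ge> 0 \<Longrightarrow>
    bounded_kirchhoff_sol (\<lambda>i x r p X. r - \<epsilon> * X + H i x p) v \<Longrightarrow> C-lipschitz_on UNIV v"
proof -
  obtain c where c: "c \<ge> 0" "\<And>i. c-lipschitz_on ({..0} \<times> {-1..1}) (\<lambda>(x, p). H i x p)"
    using Lipschitz_on_strips_uniform[OF assms(1), of 1] by auto
  define B where "B = H_bound H + c"
  have B: "H i x p \<le> B" if "x \<le> 0" "\<bar>p\<bar> \<le> 1" for i x p
  proof -
    have "\<bar>H i x 0\<bar> \<le> H_bound H"
      unfolding H_bound_def
      using cSUP_upper[of "(i, x)" "UNIV \<times> {..0}" "\<lambda>(i, x). \<bar>H i x 0\<bar>"] assms(3) that(1)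
      by (simp add: bounded_at_zero_def)
    moreover have "\<bar>H i x p - H i x 0\<bar> \<le> c * 1"
      using lipschitz_strip_slope[where h = "H i", OF c(2), of x p 0] that mult_left_mono[OF that(2) c(1)] by simp
    ultimately show ?thesis by (simp add: B_def)
  qed
  have "\<forall>i. \<exists>R. \<forall>x\<le>0. \<forall>p. \<bar>p\<bar> \<ge> R \<longrightarrow> H i x p \<ge> B + 2"
    using assms(2) unfolding uniformly_coercive_def by blast
  then obtain R where R: "\<And>i x p. x \<le> 0 \<Longrightarrow> \<bar>p\<bar> \<ge> R i \<Longrightarrow> H i x p \<ge> B + 2" by metis
  define R' where "R' = 1 + (\<Sum>i\<in>UNIV. \<bar>R i\<bar>)"
  have R'_ge: "R i \<le> R'" for i
  proof -
    have "\<bar>R i\<bar> \<le> (\<Sum>i\<in>UNIV. \<bar>R i\<bar>)" by (rule member_le_sum) auto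
    then show ?thesis by (simp add: R'_def)
  qed
  have R'_pos: "R' > 0" by (simp add: R'_def add_pos_nonneg sum_nonneg)
  show thesis
  proof (rule that)
    show "real CARD('k) * R' \<ge> 0" using R'_pos by simp
    fix \<epsilon> :: real and v
    assume \<epsilon>: "\<epsilon> \<ge> 0" and sol: "bounded_kirchhoff_sol (\<lambda>i x r p X. r - \<epsilon> * X + H i x p) v"
    from sol have v: "continuous_on UNIV v" "bounded (range v)"
      "quad_sub (\<lambda>i x r p X. r - \<epsilon> * X + H i x p) v"
      "quad_super (\<lambda>i x r p X. r - \<epsilon> * X + H i x p) v"
      unfolding bounded_kirchhoff_sol_def kirchhoff_sol_def
      using kirchhoff_sub_imp_quad_sub kirchhoff_super_imp_quad_super by blast+
    show "(real CARD('k) * R')-lipschitz_on UNIV v"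
    proof (rule viscous_sub_Lipschitz[OF v(1,2) R'_pos v(3), of "B + 1"])
      show "- (B + 1) \<le> v z" for z
      proof -
        have "- B - 1 \<le> v z"
          by (rule viscous_super_lower_bound[OF v(1,2) \<epsilon> v(4)]) (rule B)
        then show ?thesis by simp
      qed
      show "B + 1 < H i x p" if "x \<le> 0" "R' \<le> \<bar>p\<bar>" for i x p
        using R[OF that(1), of i p] R'_ge[of i] that(2) by simp
    qed
  qed
qed

lemma one_sided_estimate:
  fixes v u :: "'k::finite junction \<Rightarrow> real" and H :: "'k \<Rightarrow> real \<Rightarrow> real \<Rightarrow> real"
  assumes "\<eta> > 0" "L \<ge> 0" "\<Lambda> \<ge> 0"
    and "quad_sub (\<lambda>i x r p X. r - \<eta>\<^sup>2 * X + H i x p) v"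
    and "quad_super (\<lambda>i x r p X. r + H i x p) u"
    and "L-lipschitz_on UNIV v" "continuous_on UNIV u"
    and "bounded (range v)" "bounded (range u)"
    and strips: "Lipschitz_on_strips H"
    and "\<And>i x y p. x \<le> 0 \<Longrightarrow> y \<le> 0 \<Longrightarrow> \<bar>p\<bar> \<le> L \<Longrightarrow> \<bar>H i x p - H i y p\<bar> \<le> \<Lambda> * \<bar>x - y\<bar>"
  shows "v z - u z \<le> (1 + (L + 1)\<^sup>2 / 2 + 3 * L * (2 * L + 1) + \<Lambda> * (4 * L + 3)) * \<eta>"
    (is "_ \<le> ?C")
proof (rule field_le_epsilon)
  fix e :: real assume "e > 0"
  obtain c where c: "c \<ge> 0" "\<And>i. c-lipschitz_on ({..0} \<times> {-(L + 1)..L + 1}) (\<lambda>(x, p). H i x p)"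
    using Lipschitz_on_strips_uniform[OF strips, of "L + 1"] assms(2) by auto
  define D where "D = 3 * c + \<eta>\<^sup>2 + 1"
  have D: "D > 0" using c(1) by (simp add: D_def add_nonneg_pos)
  define \<tau> where "\<tau> = min (1 / 3) (e / D)"
  have \<tau>: "0 < \<tau>" using \<open>e > 0\<close> D by (simp add: \<tau>_def)
  have \<tau>_le: "\<tau> \<le> 1 / 3" "\<tau> \<le> e / D"
    unfolding \<tau>_def by (rule min.cobounded1, rule min.cobounded2)
  have "v z - u z \<le> ?C + D * \<tau>"
    unfolding D_def
  proof (rule one_sided_estimate_with_tolerance[OF assms(1-3) c(1) \<tau> \<tau>_le(1) assms(4-9)])
    show "\<bar>H i x p - H i y p\<bar> \<le> \<Lambda> * \<bar>x - y\<bar>" if "x \<le> 0" "y \<le> 0" "\<bar>p\<bar> \<le> L" for i x y p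
      using assms(11) that .
    show "\<bar>H i x p - H i x q\<bar> \<le> c * \<bar>p - q\<bar>"
      if "x \<le> 0" "\<bar>p\<bar> \<le> L + 1" "\<bar>q\<bar> \<le> L + 1" for i x p q
      using lipschitz_strip_slope[where h = "H i", OF c(2)] that .
  qed
  also have "D * \<tau> \<le> e" using \<tau>_le(2) D by (simp add: pos_le_divide_eq mult.commute)
  finally show "v z - u z \<le> ?C + e" by simp
qed

lemma Lipschitz_on_strips_reflect:
  assumes "Lipschitz_on_strips H"
  shows "Lipschitz_on_strips (\<lambda>i x p. - H i x (- p))"
  unfolding Lipschitz_on_strips_def
proof (intro allI impI)
  fix i and R :: real assume "R > 0"
  then obtain c where c: "c-lipschitz_on ({..0} \<times> {-R..R}) (\<lambda>(x, p). H i x p)"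
    using assms unfolding Lipschitz_on_strips_def by blast
  have "c-lipschitz_on ({..0} \<times> {-R..R}) (\<lambda>(x, p). - H i x (- p))"
  proof (rule lipschitz_onI)
    fix a b :: "real \<times> real"
    assume "a \<in> {..0} \<times> {-R..R}" "b \<in> {..0} \<times> {-R..R}"
    then show "dist (case a of (x, p) \<Rightarrow> - H i x (- p)) (case b of (x, p) \<Rightarrow> - H i x (- p))
        \<le> c * dist a b"
      using lipschitz_onD[OF c, of "(fst a, - snd a)" "(fst b, - snd b)"]
      by (cases a; cases b) (auto simp: dist_Pair_Pair dist_minus)
  qed (rule lipschitz_on_nonneg[OF c])
  then show "\<exists>c. c-lipschitz_on ({..0} \<times> {-R..R}) (\<lambda>(x, p). - H i x (- p))" by blast
qed

lemma two_sided_estimate: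
  fixes v u :: "'k::finite junction \<Rightarrow> real" and H :: "'k \<Rightarrow> real \<Rightarrow> real \<Rightarrow> real"
  assumes "\<eta> > 0" "L \<ge> 0" "\<Lambda> \<ge> 0"
    and v: "bounded_kirchhoff_sol (\<lambda>i x r p X. r - \<eta>\<^sup>2 * X + H i x p) v"
    and u: "bounded_kirchhoff_sol (\<lambda>i x r p X. r + H i x p) u"
    and lip: "L-lipschitz_on UNIV v"
    and strips: "Lipschitz_on_strips H"
    and Hx: "\<And>i x y p. x \<le> 0 \<Longrightarrow> y \<le> 0 \<Longrightarrow> \<bar>p\<bar> \<le> L \<Longrightarrow> \<bar>H i x p - H i y p\<bar> \<le> \<Lambda> * \<bar>x - y\<bar>"
  shows "\<bar>v z - u z\<bar> \<le> (1 + (L + 1)\<^sup>2 / 2 + 3 * L * (2 * L + 1) + \<Lambda> * (4 * L + 3)) * \<eta>"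
proof -
  have quad: "quad_sub (\<lambda>i x r p X. r - \<eta>\<^sup>2 * X + H i x p) v"
    "quad_super (\<lambda>i x r p X. r - \<eta>\<^sup>2 * X + H i x p) v"
    "quad_sub (\<lambda>i x r p X. r + H i x p) u" "quad_super (\<lambda>i x r p X. r + H i x p) u"
    and reg: "continuous_on UNIV u" "bounded (range v)" "bounded (range u)"
    using v u kirchhoff_sub_imp_quad_sub kirchhoff_super_imp_quad_super
    unfolding bounded_kirchhoff_sol_def kirchhoff_sol_def by blast+
  have "v z - u z \<le> (1 + (L + 1)\<^sup>2 / 2 + 3 * L * (2 * L + 1) + \<Lambda> * (4 * L + 3)) * \<eta>"
    by (rule one_sided_estimate[OF assms(1-3) quad(1,4) lip reg strips]) (rule Hx)
  moreover have "- v z - - u z \<le> (1 + (L + 1)\<^sup>2 / 2 + 3 * L * (2 * L + 1) + \<Lambda> * (4 * L + 3)) * \<eta>"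
  proof (rule one_sided_estimate[OF assms(1-3), where H = "\<lambda>i x p. - H i x (- p)"])
    show "quad_sub (\<lambda>i x r p X. r - \<eta>\<^sup>2 * X + - H i x (- p)) (\<lambda>z. - v z)"
      using quad(2) by (simp add: quad_super_def add.commute)
    show "quad_super (\<lambda>i x r p X. r + - H i x (- p)) (\<lambda>z. - u z)"
      using quad(3) by (simp add: quad_super_def add.commute)
    show "L-lipschitz_on UNIV (\<lambda>z. - v z)" using lip by (simp add: lipschitz_on_minus)
    show "continuous_on UNIV (\<lambda>z. - u z)" using reg(1) by (rule continuous_on_minus)
    show "bounded (range (\<lambda>z. - v z))" "bounded (range (\<lambda>z. - u z))"
      using reg(2,3) unfolding bounded_iff by auto
    show "\<bar>- H i x (- p) - - H i y (- p)\<bar> \<le> \<Lambda> * \<bar>x - y\<bar>"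
      if "x \<le> 0" "y \<le> 0" "\<bar>p\<bar> \<le> L" for i x y p
      using Hx[of x y "- p" i] that by (simp add: abs_minus_commute)
  qed (rule Lipschitz_on_strips_reflect[OF strips])
  ultimately show ?thesis by linarith
qed

theorem theorem1:
  shows "\<exists>C :: ennreal \<Rightarrow> real \<Rightarrow> ('k::finite \<Rightarrow> ennreal) \<Rightarrow> real.
    (\<forall>L M \<Lambda>. C L M \<Lambda> > 0) \<and>
    (\<forall>(H :: 'k \<Rightarrow> real \<Rightarrow> real \<Rightarrow> real) (u_eps :: real \<Rightarrow> 'k junction \<Rightarrow> real) L u.
       Lipschitz_on_strips H \<longrightarrow>
       uniformly_coercive H \<longrightarrow>
       bounded_at_zero H \<longrightarrow>
       (\<forall>\<epsilon>>0. bounded_kirchhoff_sol (\<lambda>i x r p X. r - \<epsilon> * X + H i x p) (u_eps \<epsilon>)) \<longrightarrow>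
       L = (SUP \<epsilon>\<in>{0<..}. Lip_on UNIV (u_eps \<epsilon>)) \<longrightarrow>
       bounded_kirchhoff_sol (\<lambda>i x r p X. r + H i x p) u \<longrightarrow>
       (\<forall>\<epsilon>>0. (SUP x. \<bar>u_eps \<epsilon> x - u x\<bar>) \<le> C L (H_bound H) (H_Lip H L) * \<epsilon> powr (1/2)))"
proof -
  \<comment> \<open>The values at \<open>L = \<infinity>\<close> and at infinite \<open>\<Lambda> i\<close> are arbitrary: both are shown to be finite.\<close>
  define C :: "ennreal \<Rightarrow> real \<Rightarrow> ('k \<Rightarrow> ennreal) \<Rightarrow> real" where
    "C = (\<lambda>L M \<Lambda>. let l = enn2real L in
       1 + (l + 1)\<^sup>2 / 2 + 3 * l * (2 * l + 1) + (\<Sum>i\<in>UNIV. enn2real (\<Lambda> i)) * (4 * l + 3))"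
  have "C L M \<Lambda> > 0" for L M \<Lambda>
    unfolding C_def Let_def
    by (intro add_pos_nonneg mult_nonneg_nonneg sum_nonneg) auto
  moreover have "(SUP x. \<bar>u_eps \<epsilon> x - u x\<bar>) \<le> C L (H_bound H) (H_Lip H L) * \<epsilon> powr (1/2)"
    if H: "Lipschitz_on_strips H" "uniformly_coercive H" "bounded_at_zero H"
      and sol: "\<forall>\<epsilon>>0. bounded_kirchhoff_sol (\<lambda>i x r p X. r - \<epsilon> * X + H i x p) (u_eps \<epsilon>)"
      and L: "L = (SUP \<epsilon>\<in>{0<..}. Lip_on UNIV (u_eps \<epsilon>))"
      and u: "bounded_kirchhoff_sol (\<lambda>i x r p X. r + H i x p) u" and \<epsilon>: "\<epsilon> > 0"
    for H :: "'k \<Rightarrow> real \<Rightarrow> real \<Rightarrow> real" and u_eps L u \<epsilon>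
  proof -
    obtain K where K: "K \<ge> 0" "\<And>\<epsilon> v. \<epsilon> \<ge> 0 \<Longrightarrow>
        bounded_kirchhoff_sol (\<lambda>i x r p X. r - \<epsilon> * X + H i x p) v \<Longrightarrow> K-lipschitz_on UNIV v"
      using viscous_solutions_equi_Lipschitz[OF H] by blast
    have "L \<le> ennreal K"
      unfolding L
    proof (rule SUP_least)
      fix e :: real assume "e \<in> {0<..}"
      then have "K-lipschitz_on UNIV (u_eps e)" using sol by (intro K(2)[of e]) auto
      then show "Lip_on UNIV (u_eps e) \<le> ennreal K" using K(1) by (simp add: Lip_on_le_iff_lipschitz_on)
    qed
    define l where "l = enn2real L"
    have l: "l \<ge> 0" "L = ennreal l"
      using le_less_trans[OF \<open>L \<le> ennreal K\<close> ennreal_less_top] by (simp_all add: l_def)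
    have lip: "l-lipschitz_on UNIV (u_eps \<epsilon>)"
    proof -
      have "Lip_on UNIV (u_eps \<epsilon>) \<le> L" unfolding L using \<epsilon> by (intro SUP_upper) auto
      then show ?thesis using l by (simp add: Lip_on_le_iff_lipschitz_on)
    qed
    define \<Lambda> where "\<Lambda> = (\<Sum>i\<in>UNIV. enn2real (H_Lip H L i))"
    have "\<bar>H i x p - H i y p\<bar> \<le> \<Lambda> * \<bar>x - y\<bar>" if "x \<le> 0" "y \<le> 0" "\<bar>p\<bar> \<le> l" for i x y p
    proof -
      define S where "S = {..0::real} \<times> {p. ennreal \<bar>p\<bar> \<le> L}"
      have S: "S = {..0} \<times> {-l..l}" using l by (auto simp: S_def)
      obtain c where c: "c \<ge> 0" "c-lipschitz_on ({..0} \<times> {-(l + 1)..l + 1}) (\<lambda>(x, p). H i x p)"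
        using Lipschitz_on_strips_uniform[OF H(1), of "l + 1"] l(1) by auto
      have "c-lipschitz_on S (\<lambda>(x, p). H i x p)"
        by (rule lipschitz_on_subset[OF c(2)]) (auto simp: S)
      then have "H_Lip H L i \<le> ennreal c"
        unfolding H_Lip_def S_def[symmetric] using c(1) by (simp add: Lip_on_le_iff_lipschitz_on)
      then have "H_Lip H L i < top" using ennreal_less_top by (rule le_less_trans)
      then have "H_Lip H L i = ennreal (enn2real (H_Lip H L i))" by simp
      then have "(enn2real (H_Lip H L i))-lipschitz_on S (\<lambda>(x, p). H i x p)"
        using Lip_on_le_iff_lipschitz_on[of "enn2real (H_Lip H L i)" S "\<lambda>(x, p). H i x p"]
        unfolding H_Lip_def S_def[symmetric] by simp
      from lipschitz_onD[OF this, of "(x, p)" "(y, p)"]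
      have "\<bar>H i x p - H i y p\<bar> \<le> enn2real (H_Lip H L i) * \<bar>x - y\<bar>"
        using that by (simp add: S dist_Pair_Pair dist_real_def abs_le_iff)
      also have "\<dots> \<le> \<Lambda> * \<bar>x - y\<bar>"
        unfolding \<Lambda>_def by (intro mult_right_mono member_le_sum) auto
      finally show ?thesis .
    qed
    moreover have "\<Lambda> \<ge> 0" by (simp add: \<Lambda>_def sum_nonneg)
    moreover have "bounded_kirchhoff_sol (\<lambda>i x r p X. r - (sqrt \<epsilon>)\<^sup>2 * X + H i x p) (u_eps \<epsilon>)"
      using sol \<epsilon> by simp
    ultimately have "\<bar>u_eps \<epsilon> z - u z\<bar> \<le> C L (H_bound H) (H_Lip H L) * sqrt \<epsilon>" for z
      unfolding C_def Let_def l_def[symmetric] \<Lambda>_def[symmetric]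
      using two_sided_estimate[of "sqrt \<epsilon>" l \<Lambda> H "u_eps \<epsilon>" u z] l(1) \<epsilon> u lip H(1) by simp
    then show ?thesis using \<epsilon> by (auto simp: powr_half_sqrt intro: cSUP_least)
  qed
  ultimately show ?thesis by blast
qed

end
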